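(* Let $p=p(n)$, $q=q(n)\in[0,1]$ satisfy $\tilde p:=p/(p+q)>2\log n/n$ and $q=\Omega(1)$ as $n\to\infty$, and let $(G_t)_{t\in\mathbb{N}}\sim\mathcal{G}(n,p,q)$ be the edge-Markovian sequence with starting graph $G_0\sim\mathcal{G}(n,\tilde p)$. Let $\pi_t$ be the stationary distribution of $G_t$. Then there exist absolute constants $c_1,c_2>0$ such that, for any starting distribution $\mu_0$ on $V$ and any $t$ with $c_1\log n\le t\le\sqrt n+c_1\log n$, $$\mathbb{P}\left[\left\|\frac{\mu_t}{\pi_t}-\mathbf 1\right\|_{2,\pi_t}^2\le c_2\right]\ge1-o_n(1).$$
   Context: $\mathcal{G}(n,\tilde p)$ is the Erdős–Rényi random graph on $V=\{1,\dots,n\}$, each of the $\binom n2$ edges being present independently with probability $\tilde p$. Edge-Markovian model $\mathcal{G}(n,p,q)$: given a starting graph $G_0$ on $V$, it is the random sequence of graphs $G_t=(V,E_t)$ in which, independently over all pairs $\{u,v\}$ of distinct vertices, $\mathbb{P}[\{u,v\}\in E_{t+1}\mid G_t]$ equals $1-q$ if $\{u,v\}\in E_t$ and $p$ if $\{u,v\}\notin E_t$. $P_t$ is the lazy random walk transition matrix on $G_t$: $P_t(u,u)=1/2$, $P_t(u,v)=1/(2\deg_t(u))$ if $\{u,v\}\in E_t$, and $P_t(u,v)=0$ otherwise, where $\deg_t(u)$ is the degree of $u$ in $G_t$ (if $\deg_t(u)=0$, $P_t(u,u)=1$). $\mu_t=\mu_0P_1P_2\cdots P_t$, and $\pi_t(x)=\deg_t(x)/(2|E_t|)$.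 For a probability distribution $\pi$ on $V$, $\|f\|_{2,\pi}=\big(\sum_{x\in V}f(x)^2\pi(x)\big)^{1/2}$; the quotient $\mu_t/\pi_t$ is entrywise and $\mathbf 1$ is the constant function $1$; if some $\pi_t(x)=0$ (or $\pi_t$ is undefined), the event in question is regarded as failing. $o_n(1)$ denotes a quantity tending to $0$ as $n\to\infty$. Probabilities are over the random graph sequence. *)

theory Defs
  imports "HOL-Probability.Probability" "HOL-Library.Landau_Symbols"
begin

text \<open>A graph on the vertex set \<open>{1..n}\<close> is represented by its edge set, an element of
  \<open>graphs n\<close>.\<close>

definition vertex_pairs :: "nat \<Rightarrow> nat set set" where
  "vertex_pairs n = {{u, v} | u v. u \<in> {1..n} \<and> v \<in> {1..n} \<and> u \<noteq> v}"

definition graphs :: "nat \<Rightarrow> nat set set set" where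
  "graphs n = Pow (vertex_pairs n)"

definition independent_edges :: "nat \<Rightarrow> (nat set \<Rightarrow> real) \<Rightarrow> nat set set pmf" where
  "independent_edges n r =
     map_pmf (\<lambda>b. {e \<in> vertex_pairs n. b e})
       (Pi_pmf (vertex_pairs n) False (\<lambda>e. bernoulli_pmf (r e)))"

definition erdos_renyi :: "nat \<Rightarrow> real \<Rightarrow> nat set set pmf" where
  "erdos_renyi n r = independent_edges n (\<lambda>_. r)"

definition edge_markovian_step :: "nat \<Rightarrow> real \<Rightarrow> real \<Rightarrow> nat set set \<Rightarrow> nat set set pmf" where
  "edge_markovian_step n p q E = independent_edges n (\<lambda>e. if e \<in> E then 1 - q else p)"

text \<open>The law of the whole sequence \<open>(G\<^sub>t)\<close> is the Ionescu-Tulcea measure of the kernels below, for a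
  random starting graph with law \<open>init\<close>. All kernels are supported on \<open>graphs n\<close>; they are restricted
  to this finite set because an event depending on finitely many graphs is then measurable.\<close>

definition edge_markovian_kernel ::
  "nat \<Rightarrow> real \<Rightarrow> real \<Rightarrow> nat set set pmf \<Rightarrow> nat \<Rightarrow> (nat \<Rightarrow> nat set set) \<Rightarrow> nat set set measure" where
  "edge_markovian_kernel n p q init t G =
     restrict_space
       (measure_pmf (case t of 0 \<Rightarrow> init | Suc s \<Rightarrow> edge_markovian_step n p q (G s))) (graphs n)"

definition edge_markovian ::
  "nat \<Rightarrow> real \<Rightarrow> real \<Rightarrow> nat set set pmf \<Rightarrow> (nat \<Rightarrow> nat set set) measure" where
  "edge_markovian n p q init =
     projective_family.lim UNIV
       (Ionescu_Tulcea.CI (edge_markovian_kernel n p q init) (\<lambda>_. count_space (graphs n)))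
       (\<lambda>_. count_space (graphs n))"

definition vertex_degree :: "nat set set \<Rightarrow> nat \<Rightarrow> nat" where
  "vertex_degree E u = card {e \<in> E. u \<in> e}"

definition lazy_walk :: "nat set set \<Rightarrow> nat \<Rightarrow> nat \<Rightarrow> real" where
  "lazy_walk E u v =
     (if u = v then (if vertex_degree E u = 0 then 1 else 1 / 2)
      else if {u, v} \<in> E then 1 / (2 * real (vertex_degree E u)) else 0)"

text \<open>The walk takes its \<open>t\<close>-th step in \<open>G t\<close>; in particular \<open>G 0\<close> is not used.\<close>

primrec walk_dist ::
  "nat \<Rightarrow> (nat \<Rightarrow> nat set set) \<Rightarrow> (nat \<Rightarrow> real) \<Rightarrow> nat \<Rightarrow> nat \<Rightarrow> real" where
  "walk_dist n G \<mu>\<^sub>0 0 = \<mu>\<^sub>0"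
| "walk_dist n G \<mu>\<^sub>0 (Suc t) = (\<lambda>y. \<Sum>x\<in>{1..n}. walk_dist n G \<mu>\<^sub>0 t x * lazy_walk (G (Suc t)) x y)"

definition stationary :: "nat set set \<Rightarrow> nat \<Rightarrow> real" where
  "stationary E x = real (vertex_degree E x) / (2 * real (card E))"

definition weighted_norm2 :: "nat \<Rightarrow> (nat \<Rightarrow> real) \<Rightarrow> (nat \<Rightarrow> real) \<Rightarrow> real" where
  "weighted_norm2 n \<pi> f = sqrt (\<Sum>x\<in>{1..n}. (f x)\<^sup>2 * \<pi> x)"

text \<open>If the graph \<open>G t\<close> has an isolated vertex, or no edges at all (where the division by zero makes
  \<open>stationary\<close> vanish), the event fails by convention.\<close>

definition well_mixed ::
  "nat \<Rightarrow> (nat \<Rightarrow> nat set set) \<Rightarrow> (nat \<Rightarrow> real) \<Rightarrow> nat \<Rightarrow> real \<Rightarrow> bool" where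
  "well_mixed n G \<mu>\<^sub>0 t c \<longleftrightarrow>
     (\<forall>x\<in>{1..n}. stationary (G t) x \<noteq> 0) \<and>
     (weighted_norm2 n (stationary (G t))
        (\<lambda>x. walk_dist n G \<mu>\<^sub>0 t x / stationary (G t) x - 1))\<^sup>2 \<le> c"


text \<open>The kernels satisfy the hypotheses of the Ionescu-Tulcea theorem, and the finite-dimensional
  distributions of \<open>edge_markovian\<close> are those of the Markov chain.\<close>

lemma finite_vertex_pairs: "finite (vertex_pairs n)"
  by (rule finite_subset[of _ "Pow {1..n}"]) (auto simp: vertex_pairs_def)

lemma finite_graphs: "finite (graphs n)"
  by (simp add: graphs_def finite_vertex_pairs)

lemma set_independent_edges: "set_pmf (independent_edges n r) \<subseteq> graphs n"
  by (auto simp: independent_edges_def graphs_def)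

lemma Ionescu_Tulcea_edge_markovian:
  assumes "set_pmf init \<subseteq> graphs n"
  shows "Ionescu_Tulcea (edge_markovian_kernel n p q init) (\<lambda>_. count_space (graphs n))"
proof -
  have supp: "set_pmf (case t of 0 \<Rightarrow> init | Suc s \<Rightarrow> edge_markovian_step n p q (G s)) \<subseteq> graphs n"
    for t G
    using assms set_independent_edges by (auto split: nat.split simp: edge_markovian_step_def)
  have prob: "prob_space (edge_markovian_kernel n p q init t G)" for t G
    unfolding edge_markovian_kernel_def
    by (rule prob_space_restrict_space)
       (auto intro!: measure_pmf.emeasure_eq_1_AE simp: AE_measure_pmf_iff subsetD[OF supp])
  have sets: "sets (edge_markovian_kernel n p q init t G) = sets (count_space (graphs n))" for t G
    by (auto simp: edge_markovian_kernel_def sets_restrict_space)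
  have in_space: "edge_markovian_kernel n p q init t G \<in> space (subprob_algebra (count_space (graphs n)))"
    for t G
    by (simp add: space_subprob_algebra sets prob prob_space_imp_subprob_space)
  have "edge_markovian_kernel n p q init t \<in>
      measurable (PiM {0..<t} (\<lambda>_. count_space (graphs n))) (subprob_algebra (count_space (graphs n)))" for t
  proof (cases t)
    case 0
    have "edge_markovian_kernel n p q init 0 = (\<lambda>_. edge_markovian_kernel n p q init 0 undefined)"
      by (auto simp: edge_markovian_kernel_def)
    then show ?thesis
      using in_space[of 0 undefined] 0 by (metis measurable_const)
  next
    case (Suc s)
    have eq: "edge_markovian_kernel n p q init (Suc s) =
        (\<lambda>E. edge_markovian_kernel n p q init (Suc s) (\<lambda>_. E)) \<circ> (\<lambda>G. G s)"
      by (auto simp: edge_markovian_kernel_def)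
    show ?thesis
      unfolding Suc
      by (subst eq, rule measurable_comp[where N = "count_space (graphs n)"])
         (auto intro: measurable_component_singleton in_space)
  qed
  then show ?thesis
    by (rule Ionescu_Tulcea.intro) (rule prob)
qed

lemma
  assumes "set_pmf init \<subseteq> graphs n"
  shows prob_space_edge_markovian: "prob_space (edge_markovian n p q init)"
    and sets_edge_markovian:
      "sets (edge_markovian n p q init) = sets (PiM UNIV (\<lambda>_. count_space (graphs n)))"
    and measure_edge_markovian:
      "\<And>g t. (\<And>i. g i \<in> graphs n) \<Longrightarrow>
        measure (edge_markovian n p q init)
          {G \<in> space (edge_markovian n p q init). \<forall>i\<le>t. G i = g i} =
        pmf init (g 0) * (\<Prod>i<t. pmf (edge_markovian_step n p q (g i)) (g (Suc i)))"
proof -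
  interpret IT: Ionescu_Tulcea "edge_markovian_kernel n p q init" "\<lambda>_. count_space (graphs n)"
    by (rule Ionescu_Tulcea_edge_markovian[OF assms])
  have lim: "edge_markovian n p q init = IT.PF.lim"
    by (simp add: edge_markovian_def)
  show sets: "sets (edge_markovian n p q init) = sets (PiM UNIV (\<lambda>_. count_space (graphs n)))"
    by (simp add: lim)
  have space: "space (edge_markovian n p q init) = (UNIV \<rightarrow> graphs n)"
    using sets_eq_imp_space_eq[OF sets] by (simp add: space_PiM PiE_def)
  have emb: "emeasure (edge_markovian n p q init) {G \<in> UNIV \<rightarrow> graphs n. restrict G {0..<m} \<in> A} =
      emeasure (IT.C 0 m (\<lambda>_. undefined)) A"
    if A: "A \<in> sets (PiM {0..<m} (\<lambda>_. count_space (graphs n)))" for m A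
  proof -
    have "A \<subseteq> space (PiM {0..<m} (\<lambda>_. count_space (graphs n)))"
      using A by (rule sets.sets_into_space)
    then have "prod_emb {0..<m} (\<lambda>_. count_space (graphs n)) {0..<m} A = A"
      by (rule prod_emb_id[unfolded space_PiM[symmetric]])
    then have "emeasure (IT.C 0 m (\<lambda>_. undefined)) A = emeasure (IT.CI {0..<m}) A"
      using A by (simp add: IT.emeasure_CI[of _ m])
    also have "\<dots> = emeasure IT.PF.lim (prod_emb UNIV (\<lambda>_. count_space (graphs n)) {0..<m} A)"
      using A by (simp add: IT.lim)
    also have "prod_emb UNIV (\<lambda>_. count_space (graphs n)) {0..<m} A =
        {G \<in> UNIV \<rightarrow> graphs n. restrict G {0..<m} \<in> A}"
      by (auto simp: prod_emb_def)
    finally show ?thesis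
      by (simp add: lim)
  qed
  show prob: "prob_space (edge_markovian n p q init)"
  proof
    have "prob_space (IT.C 0 0 (\<lambda>_. undefined))"
      by (rule IT.prob_space_C) simp
    then have "emeasure (IT.C 0 0 (\<lambda>_. undefined)) (space (PiM {0..<0} (\<lambda>_. count_space (graphs n)))) = 1"
      by (metis IT.space_C[of _ 0 0] prob_space.emeasure_space_1 add_0 PiM_empty(1) atLeastLessThan0
          insertI1 space_PiM_empty)
    moreover have "{G \<in> UNIV \<rightarrow> graphs n. restrict G {0..<0} \<in>
        space (PiM {0..<0} (\<lambda>_. count_space (graphs n)))} = space (edge_markovian n p q init)"
      by (auto simp: space space_PiM restrict_def)
    ultimately show "emeasure (edge_markovian n p q init) (space (edge_markovian n p q init)) = 1"
      using emb[OF sets.top, of 0] by simp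
  qed
  fix g :: "nat \<Rightarrow> nat set set" and t assume g: "\<And>i. g i \<in> graphs n"
  define N where "N = (\<lambda>m. PiM {0..<m} (\<lambda>_::nat. count_space (graphs n)))"
  define K where "K = (\<lambda>m. emeasure (edge_markovian_kernel n p q init m g) {g m})"
  have K: "K 0 = pmf init (g 0)" "K (Suc m) = pmf (edge_markovian_step n p q (g m)) (g (Suc m))" for m
    using g by (simp_all add: K_def edge_markovian_kernel_def emeasure_restrict_space emeasure_pmf_single)
  have sing: "{restrict g {0..<m}} \<in> sets (N m)" for m
  proof -
    have "{restrict g {0..<m}} = PiE {0..<m} (\<lambda>i. {g i})"
      by (auto simp: PiE_iff extensional_def fun_eq_iff)
    then show ?thesis
      using g by (simp add: N_def sets_PiM_I_finite)
  qed
  have C: "emeasure (IT.C 0 m (\<lambda>_. undefined)) {restrict g {0..<m}} = (\<Prod>i<m. K i)" for m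
  proof (induction m)
    case 0
    then show ?case
      using sing[of 0] by (simp add: N_def restrict_def)
  next
    case (Suc m)
    have u: "(\<lambda>_. undefined) \<in> space (N 0)"
      by (simp add: N_def)
    have sp: "space (IT.C 0 m (\<lambda>_. undefined)) = space (N m)"
      using IT.space_C[of "\<lambda>_. undefined" 0 m] by (simp add: N_def)
    have st: "sets (IT.C 0 m (\<lambda>_. undefined)) = sets (N m)"
      using IT.sets_C[of "\<lambda>_. undefined" 0 m] by (simp add: N_def)
    have eP: "emeasure (IT.eP m x) {restrict g {0..<Suc m}} = K m * indicator {restrict g {0..<m}} x"
      if x: "x \<in> space (N m)" for x
    proof -
      have x': "x \<in> extensional {0..<m}"
        using x by (auto simp: N_def space_PiM PiE_def)
      have *: "fun_upd x m y = restrict g {0..<Suc m} \<longleftrightarrow> y = g m \<and> x = restrict g {0..<m}" for y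
        using x' by (auto simp: fun_eq_iff extensional_def less_Suc_eq restrict_def)
      have "emeasure (IT.eP m x) {restrict g {0..<Suc m}} =
          emeasure (edge_markovian_kernel n p q init m x)
            ((\<lambda>y. fun_upd x m y) -` {restrict g {0..<Suc m}} \<inter> graphs n)"
        using IT.emeasure_eP[of x m "{restrict g {0..<Suc m}}"] x sing[of "Suc m"] by (simp add: N_def)
      also have "(\<lambda>y. fun_upd x m y) -` {restrict g {0..<Suc m}} \<inter> graphs n =
          (if x = restrict g {0..<m} then {g m} else {})"
        unfolding vimage_def Int_def mem_Collect_eq singleton_iff * using g by auto
      also have "emeasure (edge_markovian_kernel n p q init m x) \<dots> = K m * indicator {restrict g {0..<m}} x"
        by (auto simp: K_def edge_markovian_kernel_def split: nat.split)
      finally show ?thesis .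
    qed
    have "emeasure (IT.C 0 (Suc m) (\<lambda>_. undefined)) {restrict g {0..<Suc m}} =
        (\<integral>\<^sup>+x. emeasure (IT.eP m x) {restrict g {0..<Suc m}} \<partial>IT.C 0 m (\<lambda>_. undefined))"
    proof -
      have "space (IT.C 0 m (\<lambda>_. undefined)) \<noteq> {}"
        by (metis IT.prob_space_C prob_space.not_empty u N_def)
      moreover have "IT.eP m \<in> measurable (IT.C 0 m (\<lambda>_. undefined)) (subprob_algebra (N (Suc m)))"
        using IT.measurable_eP[of m] by (simp add: N_def measurable_cong_sets[OF st[unfolded N_def] refl])
      ultimately show ?thesis
        using sing[of "Suc m"] by (simp add: emeasure_bind)
    qed
    also have "\<dots> = (\<integral>\<^sup>+x. K m * indicator {restrict g {0..<m}} x \<partial>IT.C 0 m (\<lambda>_. undefined))"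
      by (intro nn_integral_cong eP) (simp add: sp)
    also have "\<dots> = K m * emeasure (IT.C 0 m (\<lambda>_. undefined)) {restrict g {0..<m}}"
      using sing[of m] by (simp add: nn_integral_cmult_indicator st)
    finally show ?case
      by (simp only: Suc.IH prod.lessThan_Suc mult.commute)
  qed
  have "restrict G {0..<Suc t} = restrict g {0..<Suc t} \<longleftrightarrow> (\<forall>i\<le>t. G i = g i)" for G
    unfolding restrict_def fun_eq_iff by (meson atLeastLessThan_iff less_Suc_eq_le zero_le)
  then have "{G \<in> space (edge_markovian n p q init). \<forall>i\<le>t. G i = g i} =
      {G \<in> UNIV \<rightarrow> graphs n. restrict G {0..<Suc t} \<in> {restrict g {0..<Suc t}}}"
    by (simp only: space singleton_iff)
  then have "emeasure (edge_markovian n p q init)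
      {G \<in> space (edge_markovian n p q init). \<forall>i\<le>t. G i = g i} = (\<Prod>i<Suc t. K i)"
    by (simp only: emb[OF sing[of "Suc t", unfolded N_def]] C[of "Suc t"])
  also have "\<dots> = K 0 * (\<Prod>i<t. K (Suc i))"
    by (rule prod.lessThan_Suc_shift)
  also have "\<dots> = ennreal (pmf init (g 0)) *
      ennreal (\<Prod>i<t. pmf (edge_markovian_step n p q (g i)) (g (Suc i)))"
    unfolding K by (subst prod_ennreal) simp_all
  also have "\<dots> = ennreal (pmf init (g 0) * (\<Prod>i<t. pmf (edge_markovian_step n p q (g i)) (g (Suc i))))"
    by (rule ennreal_mult[symmetric]) (simp_all add: prod_nonneg)
  finally show "measure (edge_markovian n p q init)
          {G \<in> space (edge_markovian n p q init). \<forall>i\<le>t. G i = g i} =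
        pmf init (g 0) * (\<Prod>i<t. pmf (edge_markovian_step n p q (g i)) (g (Suc i)))"
    unfolding measure_def by (simp only: enn2real_ennreal prod_nonneg mult_nonneg_nonneg pmf_nonneg)
qed

end

theory Submission
  imports Defs "HOL-Real_Asymp.Real_Asymp"
begin

text \<open>
Write \<open>r = p / (p + q)\<close> and \<open>d = n r\<close>. The Erdos-Renyi law with parameter \<open>r\<close> is stationary for the
edge-Markovian chain, so every graph \<open>G t\<close> of the sequence is itself an Erdos-Renyi graph
(\<open>prob_edge_markovian_at\<close>). It is therefore enough to find a property of a single graph that makes
one step of the lazy walk contract towards uniformity and that fails with probability \<open>o(1 / ln n)\<close>:
a union bound over the last \<open>\<lceil>3 ln n\<rceil>\<close> graphs before time \<open>t\<close> then handles all dependence in time.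

The property is \<open>well_spread\<close>: all degrees lie between \<open>d / 10\<close> and \<open>4 d\<close>, and any two vertex sets
\<open>S\<close>, \<open>T\<close> have at most \<open>C (d / n) |S| |T| + \<eta> d (|S| + |T|)\<close> edges between them, where \<open>\<eta> = 1 / 2 ^ 20\<close> is small
and \<open>C\<close> is a huge absolute constant. Distance to stationarity is measured by the energy
\<open>N = \<Sum>x. \<mu> x\<^sup>2\<close>: on a well-spread graph the stationary distribution is at least \<open>1 / (40 n)\<close>
everywhere, so the squared norm to be bounded is at most \<open>40 n N\<close>. A lazy step replaces \<open>\<mu>\<close> by the mean of
\<open>\<mu>\<close> and \<open>h = A f\<close>, where \<open>A\<close> is the adjacency matrix and \<open>f = \<mu> / deg\<close>. Since \<open>f\<close> and \<open>h\<close> are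
nonnegative, a one-sided discrepancy bound controls \<open>A\<close> on them: grouping vertices by the dyadic size of
\<open>f\<close> and \<open>h\<close> (\<open>bilinear_form_le_of_discrepancy\<close>) gives \<open>\<Sum>h\<^sup>2 \<le> N / 4 + 80 C / n\<close>, so one step sends
\<open>N\<close> to at most \<open>5/8 N + 40 C / n\<close> (\<open>lazy_walk_energy_le\<close>). From any distribution, \<open>\<lceil>3 ln n\<rceil>\<close> such steps
bring the energy to at most \<open>(1 + 107 C) / n\<close>.

That a random graph is well spread (\<open>not_well_spread_prob_le\<close>) follows from Chernoff bounds. Because \<open>C\<close>
may depend on \<open>\<eta>\<close>, the exponential moment can be taken at the large parameter \<open>\<lambda> = 3 / (2 \<eta>)\<close>; then the
term \<open>\<eta> d (|S| + |T|)\<close> alone yields the tail \<open>exp (- 3 ln n (|S| + |T|))\<close>, which beats the number of pairs of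
sets. The threshold \<open>d > 2 ln n\<close> is what makes a degree below \<open>d / 10\<close> have probability at most \<open>n powr (- 6 / 5)\<close>, small enough
for a union bound over the vertices and over the \<open>O(ln n)\<close> graphs.
\<close>

section \<open>Bilinear forms under a discrepancy bound\<close>

definition dyadic_level :: "real \<Rightarrow> int" where
  "dyadic_level a = \<lfloor>log 2 a\<rfloor>"

lemma dyadic_level_le: "a > 0 \<Longrightarrow> 2 powr dyadic_level a \<le> a"
  by (simp add: dyadic_level_def le_log_iff[symmetric])

lemma dyadic_level_less: "a > 0 \<Longrightarrow> a < 2 powr (dyadic_level a + 1)"
  by (simp add: dyadic_level_def log_less_iff[symmetric])

lemma sum_two_powr_le:
  fixes J :: "int set" and m :: int
  assumes "finite J" and "\<And>j. j \<in> J \<Longrightarrow> j \<le> m"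
  shows "(\<Sum>j\<in>J. 2 powr j) \<le> 2 * 2 powr m"
proof -
  have *: "(\<Sum>j\<in>{m - int k..m}. 2 powr j) = 2 * 2 powr m - 2 powr (m - int k)" for k
  proof (induction k)
    case (Suc k)
    have "{m - int (Suc k)..m} = insert (m - int (Suc k)) {m - int k..m}" by auto
    moreover have "(2::real) powr (m - int k) = 2 * 2 powr (m - int (Suc k))"
      by (simp add: powr_add[symmetric] powr_mult_base)
    ultimately show ?case using Suc by simp
  qed simp
  obtain l where l: "\<And>j. j \<in> J \<Longrightarrow> l \<le> j"
    using assms(1) by (metis Min_le)
  have "(\<Sum>j\<in>J. 2 powr j) \<le> (\<Sum>j\<in>{m - int (nat (m - l))..m}. 2 powr j)"
  proof (rule sum_mono2)
    show "J \<subseteq> {m - int (nat (m - l))..m}"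
      using assms(2) l by (auto; force)
  qed auto
  also have "\<dots> \<le> 2 * 2 powr m" unfolding * by simp
  finally show ?thesis .
qed

text \<open>Split the pairs \<open>(x, y)\<close> at the ratio \<open>\<theta> = 2 ^ w\<close>. If \<open>f x\<close> and \<open>g y\<close> differ by more than a factor \<open>\<theta>\<close>, then
\<open>f x * g y\<close> is at most \<open>1 / \<theta>\<close> times the larger square, and the row and column sums suffice. The
remaining pairs lie in dyadic levels whose indices differ by at most \<open>w\<close>, and on each product of two levels
\<open>f x * g y\<close> is constant up to a factor 4, so that the discrepancy bound applies. Its \<open>\<beta>\<close> part costs only a
factor of order \<open>\<theta>\<close>, because for a fixed level the sizes of the nearby levels form a geometric series. The resulting coefficient
\<open>D / \<theta> + 8 \<beta> \<theta>\<close> is small compared with \<open>D\<close> as soon as \<open>\<beta>\<close> is.\<close>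

lemma bilinear_form_le_of_discrepancy:
  fixes f g :: "'a \<Rightarrow> real" and A :: "'a \<Rightarrow> 'a \<Rightarrow> real" and w :: nat and \<alpha> \<beta> :: real
  assumes fin: "finite V"
    and f: "\<And>x. x \<in> V \<Longrightarrow> 0 \<le> f x" and g: "\<And>x. x \<in> V \<Longrightarrow> 0 \<le> g x"
    and A: "\<And>x y. x \<in> V \<Longrightarrow> y \<in> V \<Longrightarrow> 0 \<le> A x y"
    and row: "\<And>x. x \<in> V \<Longrightarrow> (\<Sum>y\<in>V. A x y) \<le> D"
    and col: "\<And>y. y \<in> V \<Longrightarrow> (\<Sum>x\<in>V. A x y) \<le> D"
    and disc: "\<And>S T. S \<subseteq> V \<Longrightarrow> T \<subseteq> V \<Longrightarrow>
      (\<Sum>x\<in>S. \<Sum>y\<in>T. A x y) \<le> \<alpha> * (card S * card T) + \<beta> * (card S + card T)"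
    and \<alpha>: "0 \<le> \<alpha>" and \<beta>: "0 \<le> \<beta>"
  shows "(\<Sum>x\<in>V. \<Sum>y\<in>V. f x * g y * A x y) \<le> 4 * \<alpha> * (\<Sum>x\<in>V. f x) * (\<Sum>y\<in>V. g y)
    + (D / 2 ^ w + 8 * \<beta> * 2 ^ w) * ((\<Sum>x\<in>V. (f x)\<^sup>2) + (\<Sum>y\<in>V. (g y)\<^sup>2))"
proof -
  define \<theta> :: real where "\<theta> = 2 ^ w"
  have \<theta>: "\<theta> > 0" and \<theta>': "\<theta> = 2 powr w" by (simp_all add: \<theta>_def powr_realpow)
  define Vf where "Vf = {x \<in> V. f x > 0}"
  define Vg where "Vg = {x \<in> V. g x > 0}"
  define I where "I = (\<lambda>x. dyadic_level (f x)) ` Vf"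
  define J where "J = (\<lambda>x. dyadic_level (g x)) ` Vg"
  define S where "S = (\<lambda>i. {x \<in> Vf. dyadic_level (f x) = i})"
  define T where "T = (\<lambda>i. {x \<in> Vg. dyadic_level (g x) = i})"
  define bal where "bal = (\<lambda>x y. f x < \<theta> * g y \<and> g y < \<theta> * f x)"
  define h where "h = (\<lambda>x y. if bal x y then f x * g y * A x y else 0)"
  define near where "near = (\<lambda>(i::int) (j::int). i \<le> j + int w \<and> j \<le> i + int w)"
  have fin': "finite Vf" "finite Vg" "finite I" "finite J"
    using fin by (auto simp: Vf_def Vg_def I_def J_def)
  have sub: "S i \<subseteq> V" "T i \<subseteq> V" for i by (auto simp: S_def T_def Vf_def Vg_def)
  have finST: "finite (S i)" "finite (T i)" for i using sub fin finite_subset by metis+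

  have split: "f x * g y * A x y \<le> (f x)\<^sup>2 / \<theta> * A x y + (g y)\<^sup>2 / \<theta> * A x y + h x y"
    if xy: "x \<in> V" "y \<in> V" for x y
  proof (cases "bal x y")
    case True
    then show ?thesis using A[OF xy] \<theta> by (simp add: h_def)
  next
    case False
    then consider "f x \<ge> \<theta> * g y" | "g y \<ge> \<theta> * f x" unfolding bal_def by linarith
    then have "f x * g y \<le> (f x)\<^sup>2 / \<theta> + (g y)\<^sup>2 / \<theta>"
    proof cases
      case 1
      have "f x * (\<theta> * g y) \<le> f x * f x" by (rule mult_left_mono[OF 1 f[OF xy(1)]])
      then have "f x * g y \<le> (f x)\<^sup>2 / \<theta>" using \<theta> by (simp add: field_simps power2_eq_square)
      then show ?thesis using \<theta> by (simp add: add_increasing2)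
    next
      case 2
      have "g y * (\<theta> * f x) \<le> g y * g y" by (rule mult_left_mono[OF 2 g[OF xy(2)]])
      then have "f x * g y \<le> (g y)\<^sup>2 / \<theta>" using \<theta> by (simp add: field_simps power2_eq_square)
      then show ?thesis using \<theta> by (simp add: add_increasing)
    qed
    then have "f x * g y * A x y \<le> ((f x)\<^sup>2 / \<theta> + (g y)\<^sup>2 / \<theta>) * A x y"
      using A[OF xy] by (rule mult_right_mono)
    then show ?thesis using False by (simp add: h_def algebra_simps)
  qed

  have unbal_f: "(\<Sum>x\<in>V. \<Sum>y\<in>V. (f x)\<^sup>2 / \<theta> * A x y) \<le> D / \<theta> * (\<Sum>x\<in>V. (f x)\<^sup>2)"
  proof -
    have "(\<Sum>y\<in>V. (f x)\<^sup>2 / \<theta> * A x y) \<le> D / \<theta> * (f x)\<^sup>2" if "x \<in> V" for x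
    proof -
      have "(\<Sum>y\<in>V. (f x)\<^sup>2 / \<theta> * A x y) = (f x)\<^sup>2 / \<theta> * (\<Sum>y\<in>V. A x y)"
        by (simp only: sum_distrib_left)
      also have "\<dots> \<le> (f x)\<^sup>2 / \<theta> * D" using row[OF that] \<theta> by (intro mult_left_mono) auto
      finally show ?thesis by (simp add: mult_ac)
    qed
    then show ?thesis by (simp only: sum_distrib_left) (rule sum_mono)
  qed
  have unbal_g: "(\<Sum>x\<in>V. \<Sum>y\<in>V. (g y)\<^sup>2 / \<theta> * A x y) \<le> D / \<theta> * (\<Sum>y\<in>V. (g y)\<^sup>2)"
  proof -
    have "(\<Sum>x\<in>V. (g y)\<^sup>2 / \<theta> * A x y) \<le> D / \<theta> * (g y)\<^sup>2" if "y \<in> V" for y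
    proof -
      have "(\<Sum>x\<in>V. (g y)\<^sup>2 / \<theta> * A x y) = (g y)\<^sup>2 / \<theta> * (\<Sum>x\<in>V. A x y)"
        by (simp only: sum_distrib_left)
      also have "\<dots> \<le> (g y)\<^sup>2 / \<theta> * D" using col[OF that] \<theta> by (intro mult_left_mono) auto
      finally show ?thesis by (simp add: mult_ac)
    qed
    then show ?thesis by (subst sum.swap) (simp only: sum_distrib_left, rule sum_mono)
  qed

  have level_f: "(\<Sum>i\<in>I. c i * real (card (S i))) = (\<Sum>x\<in>Vf. c (dyadic_level (f x)))" for c
    using sum.image_gen[OF fin'(1), of "\<lambda>x. c (dyadic_level (f x))" "\<lambda>x. dyadic_level (f x)"]
    by (simp add: I_def S_def mult.commute)
  have level_g: "(\<Sum>j\<in>J. c j * real (card (T j))) = (\<Sum>x\<in>Vg. c (dyadic_level (g x)))" for c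
    using sum.image_gen[OF fin'(2), of "\<lambda>x. c (dyadic_level (g x))" "\<lambda>x. dyadic_level (g x)"]
    by (simp add: J_def T_def mult.commute)
  have mass_f: "(\<Sum>i\<in>I. 2 powr i * card (S i)) \<le> (\<Sum>x\<in>V. f x)"
    and energy_f: "(\<Sum>i\<in>I. (2 powr i)\<^sup>2 * card (S i)) \<le> (\<Sum>x\<in>V. (f x)\<^sup>2)"
    unfolding level_f
    by (intro sum_le_included[where i = "\<lambda>x. x"]; use fin fin' f in
      \<open>auto simp: Vf_def dyadic_level_le intro!: power_mono\<close>)+
  have mass_g: "(\<Sum>j\<in>J. 2 powr j * card (T j)) \<le> (\<Sum>x\<in>V. g x)"
    and energy_g: "(\<Sum>j\<in>J. (2 powr j)\<^sup>2 * card (T j)) \<le> (\<Sum>x\<in>V. (g x)\<^sup>2)"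
    unfolding level_g
    by (intro sum_le_included[where i = "\<lambda>x. x"]; use fin fin' g in
      \<open>auto simp: Vg_def dyadic_level_le intro!: power_mono\<close>)+

  have near_bal: "near (dyadic_level (f x)) (dyadic_level (g y))"
    if "x \<in> Vf" "y \<in> Vg" "bal x y" for x y
  proof -
    have p: "f x > 0" "g y > 0" using that by (auto simp: Vf_def Vg_def)
    have *: "dyadic_level a \<le> dyadic_level b + int w" if "a < \<theta> * b" "a > 0" "b > 0" for a b
    proof -
      have "2 powr dyadic_level a \<le> a" using that by (simp add: dyadic_level_le)
      also have "a < \<theta> * b" by fact
      also have "\<dots> < \<theta> * 2 powr (dyadic_level b + 1)"
        using \<theta> dyadic_level_less[OF that(3)] by simp
      also have "\<dots> = 2 powr (dyadic_level b + 1 + w)"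
        by (simp add: \<theta>' powr_add)
      finally have "real_of_int (dyadic_level a) < dyadic_level b + 1 + w" by simp
      then show ?thesis by linarith
    qed
    show ?thesis using that(3) p * by (auto simp: near_def bal_def)
  qed

  define c where "c = (\<lambda>i j. 4 * (2 powr real_of_int i * 2 powr real_of_int j) :: real)"
  \<comment> \<open>The factor 4 is lost by replacing \<open>f x\<close> and \<open>g y\<close> by the
    lower ends of their dyadic levels.\<close>
  have block: "(\<Sum>x\<in>S i. \<Sum>y\<in>T j. h x y) \<le>
      4 * \<alpha> * ((2 powr i * card (S i)) * (2 powr j * card (T j)))
      + 4 * \<beta> * (2 powr i * card (S i) * (if near i j then 2 powr j else 0))
      + 4 * \<beta> * (2 powr j * card (T j) * (if near i j then 2 powr i else 0))" for i j
  proof (cases "near i j")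
    case True
    have "h x y \<le> c i j * A x y" if "x \<in> S i" "y \<in> T j" for x y
    proof -
      have xy: "x \<in> V" "y \<in> V" using that sub by auto
      have "f x \<le> 2 * 2 powr i" "g y \<le> 2 * 2 powr j"
        using that dyadic_level_less[of "f x"] dyadic_level_less[of "g y"]
        by (auto simp: S_def T_def Vf_def Vg_def powr_add)
      then have "f x * g y \<le> (2 * 2 powr i) * (2 * 2 powr j)"
        using f[OF xy(1)] g[OF xy(2)] by (intro mult_mono) auto
      also have "\<dots> = c i j" by (simp add: c_def)
      finally have "f x * g y * A x y \<le> c i j * A x y"
        using A[OF xy] by (rule mult_right_mono)
      moreover have "0 \<le> c i j * A x y" using A[OF xy] by (simp add: c_def)
      ultimately show ?thesis by (simp add: h_def)
    qed
    then have "(\<Sum>x\<in>S i. \<Sum>y\<in>T j. h x y) \<le> (\<Sum>x\<in>S i. \<Sum>y\<in>T j. c i j * A x y)"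
      by (intro sum_mono)
    also have "\<dots> = c i j * (\<Sum>x\<in>S i. \<Sum>y\<in>T j. A x y)"
      by (simp add: sum_distrib_left)
    also have "\<dots> \<le> c i j * (\<alpha> * (card (S i) * card (T j)) + \<beta> * (card (S i) + card (T j)))"
      using disc[OF sub(1)[of i] sub(2)[of j]] by (intro mult_left_mono) (auto simp: c_def)
    finally show ?thesis using True by (simp add: c_def algebra_simps)
  next
    case False
    have "h x y = 0" if "x \<in> S i" "y \<in> T j" for x y
      using that near_bal[of x y] False by (auto simp: S_def T_def h_def)
    then have "(\<Sum>x\<in>S i. \<Sum>y\<in>T j. h x y) = 0" by simp
    then show ?thesis using False \<alpha> by simp
  qed

  have nearsum: "(\<Sum>j\<in>K. if near i j then 2 powr j else 0) \<le> 2 * \<theta> * 2 powr i"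
    if "finite K" for K i
  proof -
    have "(\<Sum>j\<in>K. if near i j then 2 powr j else 0) = (\<Sum>j\<in>{j\<in>K. near i j}. 2 powr j)"
      using that by (simp add: sum.inter_filter)
    also have "\<dots> \<le> 2 * 2 powr (i + int w)"
      by (rule order_trans[OF sum_two_powr_le[of _ "i + int w"]]) (use that in \<open>auto simp: near_def\<close>)
    finally show ?thesis by (simp add: \<theta>' powr_add mult_ac)
  qed
  have nearsym: "near i j = near j i" for i j by (auto simp: near_def)

  have "(\<Sum>x\<in>V. \<Sum>y\<in>V. h x y) = (\<Sum>x\<in>Vf. \<Sum>y\<in>V. h x y)"
    using f fin by (intro sum.mono_neutral_right)
      (force simp: Vf_def h_def intro!: sum.neutral)+
  also have "\<dots> = (\<Sum>x\<in>Vf. \<Sum>y\<in>Vg. h x y)"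
    using g fin by (intro sum.cong refl sum.mono_neutral_right)
      (force simp: Vg_def h_def)+
  also have "\<dots> = (\<Sum>x\<in>Vf. \<Sum>j\<in>J. \<Sum>y\<in>T j. h x y)"
    unfolding J_def T_def by (intro sum.cong refl sum.image_gen fin')
  also have "\<dots> = (\<Sum>i\<in>I. \<Sum>x\<in>S i. \<Sum>j\<in>J. \<Sum>y\<in>T j. h x y)"
    unfolding I_def S_def by (intro sum.image_gen fin')
  also have "\<dots> = (\<Sum>i\<in>I. \<Sum>j\<in>J. \<Sum>x\<in>S i. \<Sum>y\<in>T j. h x y)"
    by (intro sum.cong refl sum.swap)
  also have "\<dots> \<le> (\<Sum>i\<in>I. \<Sum>j\<in>J. 
      4 * \<alpha> * ((2 powr i * card (S i)) * (2 powr j * card (T j)))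
      + 4 * \<beta> * (2 powr i * card (S i) * (if near i j then 2 powr j else 0))
      + 4 * \<beta> * (2 powr j * card (T j) * (if near i j then 2 powr i else 0)))"
    by (intro sum_mono block)
  also have "\<dots> = 4 * \<alpha> * ((\<Sum>i\<in>I. 2 powr i * card (S i)) * (\<Sum>j\<in>J. 2 powr j * card (T j)))
     + 4 * \<beta> * (\<Sum>i\<in>I. 2 powr i * card (S i) * (\<Sum>j\<in>J. if near i j then 2 powr j else 0))
     + 4 * \<beta> * (\<Sum>j\<in>J. 2 powr j * card (T j) * (\<Sum>i\<in>I. if near j i then 2 powr i else 0))"
  proof -
    have "(\<Sum>i\<in>I. \<Sum>j\<in>J. 4 * \<alpha> * (a i * b j)) = 4 * \<alpha> * (sum a I * sum b J)" for a b
      unfolding sum_product by (simp only: sum_distrib_left)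
    moreover have "(\<Sum>i\<in>I. \<Sum>j\<in>J. 4 * \<beta> * (2 powr j * card (T j) * (if near i j then 2 powr i else 0))) =
        4 * \<beta> * (\<Sum>j\<in>J. 2 powr j * card (T j) * (\<Sum>i\<in>I. if near j i then 2 powr i else 0))"
      by (subst sum.swap) (simp only: sum_distrib_left nearsym)
    ultimately show ?thesis
      unfolding sum.distrib by (simp only: sum_distrib_left)
  qed
  also have "\<dots> \<le> 4 * \<alpha> * ((\<Sum>x\<in>V. f x) * (\<Sum>y\<in>V. g y))
     + 4 * \<beta> * (\<Sum>i\<in>I. 2 powr i * card (S i) * (2 * \<theta> * 2 powr i))
     + 4 * \<beta> * (\<Sum>j\<in>J. 2 powr j * card (T j) * (2 * \<theta> * 2 powr j))"
    using \<alpha> \<beta> fin' f g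
    by (intro add_mono mult_left_mono mult_mono mass_f mass_g sum_mono nearsum sum_nonneg) auto
  also have "\<dots> = 4 * \<alpha> * ((\<Sum>x\<in>V. f x) * (\<Sum>y\<in>V. g y))
     + 8 * \<beta> * \<theta> * ((\<Sum>i\<in>I. (2 powr i)\<^sup>2 * card (S i)) + (\<Sum>j\<in>J. (2 powr j)\<^sup>2 * card (T j)))"
    by (simp add: power2_eq_square sum_distrib_left algebra_simps)
  also have "\<dots> \<le> 4 * \<alpha> * ((\<Sum>x\<in>V. f x) * (\<Sum>y\<in>V. g y))
     + 8 * \<beta> * \<theta> * ((\<Sum>x\<in>V. (f x)\<^sup>2) + (\<Sum>y\<in>V. (g y)\<^sup>2))"
    using \<beta> \<theta> by (intro add_left_mono mult_left_mono add_mono energy_f energy_g) auto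
  finally have bal_part: "(\<Sum>x\<in>V. \<Sum>y\<in>V. h x y) \<le> \<dots>" .
  have "(\<Sum>x\<in>V. \<Sum>y\<in>V. f x * g y * A x y) \<le>
      (\<Sum>x\<in>V. \<Sum>y\<in>V. (f x)\<^sup>2 / \<theta> * A x y + (g y)\<^sup>2 / \<theta> * A x y + h x y)"
    by (intro sum_mono split)
  also have "\<dots> = (\<Sum>x\<in>V. \<Sum>y\<in>V. (f x)\<^sup>2 / \<theta> * A x y) + (\<Sum>x\<in>V. \<Sum>y\<in>V. (g y)\<^sup>2 / \<theta> * A x y)
      + (\<Sum>x\<in>V. \<Sum>y\<in>V. h x y)"
    by (simp add: sum.distrib)
  finally show ?thesis
    using unbal_f unbal_g bal_part unfolding \<theta>_def[symmetric]
    by (simp add: algebra_simps)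
qed

section \<open>Exponential tail bounds for edge counts of the random graph\<close>

lemma erdos_renyi_mgf:
  fixes r :: real and w :: "nat set \<Rightarrow> real"
  assumes r: "0 \<le> r" "r \<le> 1"
  shows "measure_pmf.expectation (erdos_renyi n r) (\<lambda>E. exp (\<Sum>e\<in>E. w e)) =
    (\<Prod>e\<in>vertex_pairs n. 1 + r * (exp (w e) - 1))"
proof -
  have "measure_pmf.expectation (erdos_renyi n r) (\<lambda>E. exp (\<Sum>e\<in>E. w e)) =
      measure_pmf.expectation (Pi_pmf (vertex_pairs n) False (\<lambda>_. bernoulli_pmf r))
        (\<lambda>b. \<Prod>e\<in>vertex_pairs n. if b e then exp (w e) else 1)"
    unfolding erdos_renyi_def independent_edges_def integral_map_pmf
    by (intro Bochner_Integration.integral_cong refl)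
       (simp add: exp_sum finite_vertex_pairs prod.inter_filter)
  also have "\<dots> = (\<Prod>e\<in>vertex_pairs n. measure_pmf.expectation (bernoulli_pmf r)
      (\<lambda>v. if v then exp (w e) else 1))"
    by (rule expectation_prod_Pi_pmf)
       (auto simp: finite_vertex_pairs intro: integrable_measure_pmf_finite)
  also have "\<dots> = (\<Prod>e\<in>vertex_pairs n. 1 + r * (exp (w e) - 1))"
    using r by (simp add: algebra_simps)
  finally show ?thesis .
qed

text \<open>Markov's inequality for the exponential moment, with \<open>1 + z \<le> exp z\<close> in each factor. The weights may
have either sign, so the bound serves for upper and lower tails.\<close>

lemma erdos_renyi_chernoff:
  fixes r k :: real and w :: "nat set \<Rightarrow> real"
  assumes r: "0 \<le> r" "r \<le> 1"
  shows "measure_pmf.prob (erdos_renyi n r) {E. (\<Sum>e\<in>E. w e) \<ge> k} \<le>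
    exp (r * (\<Sum>e\<in>vertex_pairs n. exp (w e) - 1) - k)"
proof -
  have fin: "finite (set_pmf (erdos_renyi n r))"
    using finite_graphs set_independent_edges unfolding erdos_renyi_def by (rule rev_finite_subset)
  have "measure_pmf.prob (erdos_renyi n r) {E \<in> space (erdos_renyi n r). exp (\<Sum>e\<in>E. w e) \<ge> exp k}
      \<le> measure_pmf.expectation (erdos_renyi n r) (\<lambda>E. exp (\<Sum>e\<in>E. w e)) / exp k"
    by (rule integral_Markov_inequality_measure[where A = "{}"])
       (auto intro: integrable_measure_pmf_finite fin)
  also have "\<dots> = (\<Prod>e\<in>vertex_pairs n. 1 + r * (exp (w e) - 1)) / exp k"
    by (simp add: erdos_renyi_mgf[OF r])
  also have "\<dots> \<le> (\<Prod>e\<in>vertex_pairs n. exp (r * (exp (w e) - 1))) / exp k"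
  proof (intro divide_right_mono prod_mono conjI exp_ge_add_one_self)
    fix e
    have "r * (exp (w e) - 1) \<ge> r * (0 - 1)" using r by (intro mult_left_mono) auto
    then show "0 \<le> 1 + r * (exp (w e) - 1)" using r by simp
  qed simp
  also have "\<dots> = exp (r * (\<Sum>e\<in>vertex_pairs n. exp (w e) - 1) - k)"
    by (simp add: exp_sum[symmetric] finite_vertex_pairs exp_diff sum_distrib_left)
  finally show ?thesis by simp
qed

lemma vertex_degree_eq_card_neighbours:
  assumes "E \<in> graphs n" and "x \<in> {1..n}"
  shows "vertex_degree E x = card {y \<in> {1..n}. {x, y} \<in> E}"
proof -
  have "{e \<in> E. x \<in> e} = (\<lambda>y. {x, y}) ` {y \<in> {1..n}. {x, y} \<in> E}"
  proof
    show "{e \<in> E. x \<in> e} \<subseteq> (\<lambda>y. {x, y}) ` {y \<in> {1..n}. {x, y} \<in> E}"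
    proof
      fix e assume e: "e \<in> {e \<in> E. x \<in> e}"
      then obtain u v where uv: "e = {u, v}" "u \<in> {1..n}" "v \<in> {1..n}"
        using assms(1) unfolding graphs_def vertex_pairs_def by blast
      then have "e = {x, v} \<or> e = {x, u}" using e by blast
      then show "e \<in> (\<lambda>y. {x, y}) ` {y \<in> {1..n}. {x, y} \<in> E}"
        using e uv(2,3) by blast
    qed
  qed auto
  moreover have "inj_on (\<lambda>y. {x, y}) {y \<in> {1..n}. {x, y} \<in> E}"
    by (auto simp: inj_on_def doubleton_eq_iff)
  ultimately show ?thesis by (simp add: vertex_degree_def card_image)
qed

lemma card_vertex_pairs_containing:
  assumes "x \<in> {1..n}"
  shows "card {e \<in> vertex_pairs n. x \<in> e} = n - 1"
proof -
  have "card {e \<in> vertex_pairs n. x \<in> e} = card {y \<in> {1..n}. {x, y} \<in> vertex_pairs n}"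
    using vertex_degree_eq_card_neighbours[of "vertex_pairs n" n x] assms
    by (simp add: graphs_def vertex_degree_def)
  also have "{y \<in> {1..n}. {x, y} \<in> vertex_pairs n} = {1..n} - {x}"
    using assms unfolding vertex_pairs_def by (blast dest: doubleton_eq_iff[THEN iffD1])
  finally show ?thesis using assms by simp
qed

lemma vertex_degree_eq_sum:
  assumes "E \<in> graphs n"
  shows "real (vertex_degree E x) = (\<Sum>e\<in>E. of_bool (x \<in> e))"
proof -
  have "finite E" using assms finite_vertex_pairs finite_subset by (auto simp: graphs_def)
  then show ?thesis by (simp add: vertex_degree_def Int_def)
qed

text \<open>A negative \<open>l\<close> gives the lower tail of the degree.\<close>

lemma erdos_renyi_degree_tail:
  fixes r l k :: real
  assumes r: "0 \<le> r" "r \<le> 1" and x: "x \<in> {1..n}"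
  shows "measure_pmf.prob (erdos_renyi n r) {E. l * vertex_degree E x \<ge> k} \<le>
    exp (r * (real n - 1) * (exp l - 1) - k)"
proof -
  have "measure_pmf.prob (erdos_renyi n r) {E. l * vertex_degree E x \<ge> k} =
      measure_pmf.prob (erdos_renyi n r) {E. (\<Sum>e\<in>E. l * of_bool (x \<in> e)) \<ge> k}"
  proof (rule measure_pmf.finite_measure_eq_AE)
    show "AE E in erdos_renyi n r. (E \<in> {E. k \<le> l * vertex_degree E x}) =
        (E \<in> {E. (\<Sum>e\<in>E. l * of_bool (x \<in> e)) \<ge> k})"
      using set_independent_edges[of n "\<lambda>_. r"]
      by (auto simp: AE_measure_pmf_iff erdos_renyi_def vertex_degree_eq_sum sum_distrib_left
          simp del: sum_of_bool_eq)
  qed auto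
  also have "\<dots> \<le> exp (r * (\<Sum>e\<in>vertex_pairs n. exp (l * of_bool (x \<in> e)) - 1) - k)"
    by (rule erdos_renyi_chernoff[OF r])
  also have "(\<Sum>e\<in>vertex_pairs n. exp (l * of_bool (x \<in> e)) - 1) =
      (\<Sum>e\<in>vertex_pairs n. (exp l - 1) * of_bool (x \<in> e))"
    by (intro sum.cong) auto
  also have "\<dots> = (exp l - 1) * card {e \<in> vertex_pairs n. x \<in> e}"
    by (simp add: sum_distrib_left[symmetric] finite_vertex_pairs Int_def)
  also have "\<dots> = (real n - 1) * (exp l - 1)"
    using x by (simp add: card_vertex_pairs_containing of_nat_diff)
  finally show ?thesis by (simp add: mult_ac)
qed

definition edges_between :: "nat set set \<Rightarrow> nat set \<Rightarrow> nat set \<Rightarrow> nat" where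
  "edges_between E S T = card {(x, y) \<in> S \<times> T. {x, y} \<in> E}"

text \<open>An edge with both ends in \<open>S \<inter> T\<close> is counted twice by \<open>edges_between\<close>; the summand is this multiplicity.\<close>

lemma edges_between_eq_sum:
  assumes "finite E" "finite S" "finite T"
  shows "edges_between E S T = (\<Sum>e\<in>E. card {(x, y) \<in> S \<times> T. {x, y} = e})"
proof -
  have fin: "finite {(x, y) \<in> S \<times> T. {x, y} = e}" for e
    by (rule finite_subset[of _ "S \<times> T"]) (use assms in auto)
  have "{(x, y) \<in> S \<times> T. {x, y} \<in> E} = (\<Union>e\<in>E. {(x, y) \<in> S \<times> T. {x, y} = e})" by auto
  then show ?thesis
    unfolding edges_between_def by (simp only:) (rule card_UN_disjoint; use assms fin in auto)
qed

text \<open>The edge count is a sum of independent indicators with multiplicities \<open>c e \<le> 2\<close> of total at most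
\<open>|S| |T|\<close>. The possible multiplicity 2 is the reason for the exponent \<open>2 * l\<close>.\<close>

lemma erdos_renyi_edges_between_tail:
  fixes r l k :: real
  assumes r: "0 \<le> r" "r \<le> 1" and l: "0 \<le> l" and S: "S \<subseteq> {1..n}" and T: "T \<subseteq> {1..n}"
  shows "measure_pmf.prob (erdos_renyi n r) {E. l * edges_between E S T \<ge> k} \<le>
    exp (r * (card S * card T) * (exp (2 * l) - 1) - k)"
proof -
  have fin: "finite S" "finite T" using S T finite_subset by auto
  define c where "c = (\<lambda>e. card {(x, y) \<in> S \<times> T. {x, y} = e})"
  have c2: "c e \<le> 2" for e
  proof (cases "\<exists>x y. e = {x, y}")
    case True
    then obtain x y where "e = {x, y}" by auto
    then have "{(x, y) \<in> S \<times> T. {x, y} = e} \<subseteq> {(x, y), (y, x)}"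
      by (auto simp: doubleton_eq_iff)
    then have "c e \<le> card {(x, y), (y, x)}" unfolding c_def by (intro card_mono) auto
    also have "\<dots> \<le> 2" using card_length[of "[(x, y), (y, x)]"] by simp
    finally show ?thesis .
  next
    case False
    then have "{(x, y) \<in> S \<times> T. {x, y} = e} = {}" by blast
    then show ?thesis unfolding c_def by (simp only: card.empty)
  qed
  have total: "(\<Sum>e\<in>vertex_pairs n. c e) \<le> card S * card T"
  proof -
    have "(\<Sum>e\<in>vertex_pairs n. c e) = edges_between (vertex_pairs n) S T"
      unfolding c_def by (simp add: edges_between_eq_sum finite_vertex_pairs fin)
    also have "\<dots> \<le> card (S \<times> T)"
      unfolding edges_between_def by (intro card_mono) (use fin in auto)
    finally show ?thesis by (simp add: card_cartesian_product)
  qed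
  have "measure_pmf.prob (erdos_renyi n r) {E. l * edges_between E S T \<ge> k} =
      measure_pmf.prob (erdos_renyi n r) {E. (\<Sum>e\<in>E. l * c e) \<ge> k}"
  proof (rule measure_pmf.finite_measure_eq_AE)
    have "finite E" if "E \<in> set_pmf (erdos_renyi n r)" for E
    proof -
      have "E \<in> graphs n"
        using that set_independent_edges[of n "\<lambda>_. r"] unfolding erdos_renyi_def by (rule rev_subsetD)
      then show ?thesis
        unfolding graphs_def by (auto intro: finite_subset[OF _ finite_vertex_pairs])
    qed
    then show "AE E in erdos_renyi n r. (E \<in> {E. k \<le> l * edges_between E S T}) =
        (E \<in> {E. (\<Sum>e\<in>E. l * c e) \<ge> k})"
      by (auto simp: AE_measure_pmf_iff edges_between_eq_sum fin c_def sum_distrib_left)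
  qed auto
  also have "\<dots> \<le> exp (r * (\<Sum>e\<in>vertex_pairs n. exp (l * c e) - 1) - k)"
    by (rule erdos_renyi_chernoff[OF r])
  also have "\<dots> \<le> exp (r * ((card S * card T) * (exp (2 * l) - 1)) - k)"
  proof -
    have "exp (l * c e) - 1 \<le> c e * (exp (2 * l) - 1)" for e
    proof (cases "c e = 0")
      case False
      have "exp (l * c e) - 1 \<le> exp (2 * l) - 1"
        using c2[of e] l by (simp add: mult.commute mult_left_mono)
      also have "\<dots> = 1 * (exp (2 * l) - 1)" by simp
      also have "\<dots> \<le> c e * (exp (2 * l) - 1)"
        using l False by (intro mult_right_mono) auto
      finally show ?thesis .
    qed simp
    then have "(\<Sum>e\<in>vertex_pairs n. exp (l * c e) - 1) \<le> (\<Sum>e\<in>vertex_pairs n. c e * (exp (2 * l) - 1))"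
      by (intro sum_mono)
    also have "\<dots> = real (\<Sum>e\<in>vertex_pairs n. c e) * (exp (2 * l) - 1)"
      by (simp add: sum_distrib_right)
    also have "\<dots> \<le> real (card S * card T) * (exp (2 * l) - 1)"
      using total l by (intro mult_right_mono) (auto simp del: of_nat_sum of_nat_mult)
    finally show ?thesis using r by (simp add: mult_left_mono)
  qed
  finally show ?thesis by (simp add: mult_ac)
qed

text \<open>The generating function that evaluates the union bound over all vertex sets.\<close>

lemma sum_Pow_power_card:
  fixes y :: real
  assumes "finite V"
  shows "(\<Sum>S\<in>Pow V. y ^ card S) = (1 + y) ^ card V"
  using prod_add[OF assms, of "\<lambda>_. y" "\<lambda>_. 1"] by (simp add: add.commute)

section \<open>Stationarity of the edge-Markovian sequence\<close>

text \<open>The edges evolve independently, and the Bernoulli law with parameter \<open>p / (p + q)\<close> is stationary for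
the two-state chain of a single edge.\<close>

lemma erdos_renyi_stationary:
  fixes p q :: real
  assumes p: "0 \<le> p" "p \<le> 1" and q: "0 \<le> q" "q \<le> 1" and pq: "p + q > 0"
  shows "bind_pmf (erdos_renyi n (p / (p + q))) (edge_markovian_step n p q) =
    erdos_renyi n (p / (p + q))"
proof -
  define r where "r = p / (p + q)"
  have r: "0 \<le> r" "r \<le> 1" using p q pq by (auto simp: r_def)
  let ?V = "vertex_pairs n"
  let ?B = "Pi_pmf ?V False (\<lambda>_. bernoulli_pmf r)"
  let ?graph = "\<lambda>b. {e \<in> ?V. b e}"
  have step: "bind_pmf (bernoulli_pmf r) (\<lambda>b. bernoulli_pmf (if b then 1 - q else p)) = bernoulli_pmf r"
  proof (rule pmf_eqI)
    fix b
    have "r * (1 - q) + (1 - r) * p = r"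
    proof -
      have "r * (p + q) = p" using pq by (simp add: r_def)
      then show ?thesis by (simp add: algebra_simps)
    qed
    then show "pmf (bind_pmf (bernoulli_pmf r) (\<lambda>b. bernoulli_pmf (if b then 1 - q else p))) b =
        pmf (bernoulli_pmf r) b"
      using r p q by (cases b) (simp_all add: pmf_bind algebra_simps)
  qed
  have "bind_pmf (erdos_renyi n r) (edge_markovian_step n p q) =
      bind_pmf ?B (\<lambda>b. map_pmf ?graph
        (Pi_pmf ?V False (\<lambda>e. bernoulli_pmf (if e \<in> ?graph b then 1 - q else p))))"
    by (simp add: erdos_renyi_def edge_markovian_step_def independent_edges_def bind_map_pmf)
  also have "\<dots> = bind_pmf ?B (\<lambda>b. map_pmf ?graph
        (Pi_pmf ?V False (\<lambda>e. bernoulli_pmf (if b e then 1 - q else p))))"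
    by (intro bind_pmf_cong refl arg_cong[where f = "map_pmf _"] Pi_pmf_cong) auto
  also have "\<dots> = map_pmf ?graph (bind_pmf ?B (\<lambda>b. 
        Pi_pmf ?V False (\<lambda>e. bernoulli_pmf (if b e then 1 - q else p))))"
    by (simp add: map_bind_pmf)
  also have "bind_pmf ?B (\<lambda>b. Pi_pmf ?V False (\<lambda>e. bernoulli_pmf (if b e then 1 - q else p))) = ?B"
    by (subst Pi_pmf_bind[OF finite_vertex_pairs, symmetric]) (simp add: step)
  finally show ?thesis by (simp add: r_def erdos_renyi_def independent_edges_def)
qed

lemma space_edge_markovian:
  assumes "set_pmf init \<subseteq> graphs n"
  shows "space (edge_markovian n p q init) = UNIV \<rightarrow> graphs n"
  using sets_eq_imp_space_eq[OF sets_edge_markovian[OF assms]] by (simp add: space_PiM PiE_def)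

lemma cylinder_in_sets_edge_markovian:
  assumes "set_pmf init \<subseteq> graphs n" and "finite K"
  shows "{G \<in> space (edge_markovian n p q init). \<forall>i\<in>K. G i = h i} \<in> sets (edge_markovian n p q init)"
proof -
  let ?P = "PiM UNIV (\<lambda>_::nat. count_space (graphs n))"
  have comp: "(\<lambda>G. G i) \<in> measurable ?P (count_space (graphs n))" for i
    by measurable
  have "{G \<in> space ?P. G i = h i} \<in> sets ?P" for i
  proof -
    have "(\<lambda>G. G i) -` ({h i} \<inter> graphs n) \<inter> space ?P \<in> sets ?P"
      by (rule measurable_sets[OF comp]) simp
    also have "(\<lambda>G. G i) -` ({h i} \<inter> graphs n) \<inter> space ?P = {G \<in> space ?P. G i = h i}"
      by (auto simp: space_PiM)
    finally show ?thesis .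
  qed
  then have "{G \<in> space ?P. \<forall>i\<in>K. G i = h i} \<in> sets ?P"
    using assms(2) by (intro sets.sets_Collect_finite_All) auto
  then show ?thesis
    unfolding sets_edge_markovian[OF assms(1)] sets_eq_imp_space_eq[OF sets_edge_markovian[OF assms(1)]] .
qed

lemma finite_prefixes: "finite (PiE {..t} (\<lambda>_::nat. graphs n))"
  by (intro finite_PiE finite_graphs) auto

text \<open>An event that depends on the graphs up to time \<open>t\<close> is a finite union of cylinders, because there are
finitely many graphs.\<close>

lemma sets_edge_markovian_prefix:
  assumes init: "set_pmf init \<subseteq> graphs n"
    and Q: "\<And>G H. (\<And>i. i \<le> t \<Longrightarrow> G i = H i) \<Longrightarrow> Q G = Q H"
  shows "{G \<in> space (edge_markovian n p q init). Q G} \<in> sets (edge_markovian n p q init)"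
proof -
  let ?M = "edge_markovian n p q init"
  have "{G \<in> space ?M. Q G} =
      (\<Union>h\<in>{h \<in> PiE {..t} (\<lambda>_. graphs n). Q h}. {G \<in> space ?M. \<forall>i\<in>{..t}. G i = h i})"
    (is "?L = ?R")
  proof
    show "?L \<subseteq> ?R"
    proof
      fix G assume G: "G \<in> ?L"
      then have "restrict G {..t} \<in> PiE {..t} (\<lambda>_. graphs n)"
        by (auto simp: space_edge_markovian[OF init])
      moreover have "Q (restrict G {..t})" using G Q[of G "restrict G {..t}"] by auto
      ultimately have "restrict G {..t} \<in> {h \<in> PiE {..t} (\<lambda>_. graphs n). Q h}" by simp
      moreover have "G \<in> {H \<in> space ?M. \<forall>i\<in>{..t}. H i = restrict G {..t} i}" using G by simp
      ultimately show "G \<in> ?R"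
        by (rule UN_I[where B = "\<lambda>h. {G \<in> space ?M. \<forall>i\<in>{..t}. G i = h i}"])
    qed
    show "?R \<subseteq> ?L"
    proof
      fix G assume "G \<in> ?R"
      then obtain h where h: "Q h" "G \<in> space ?M" "\<forall>i\<in>{..t}. G i = h i" by blast
      moreover have "Q G = Q h" by (rule Q) (use h(3) in simp)
      ultimately show "G \<in> ?L" by simp
    qed
  qed
  also have "\<dots> \<in> sets ?M"
    by (intro sets.finite_UN cylinder_in_sets_edge_markovian[OF init])
       (auto intro: finite_subset[OF _ finite_prefixes])
  finally show ?thesis .
qed

text \<open>The law of total probability for a finite-valued \<open>F\<close>; measurability comes from \<open>Q\<close> and \<open>F\<close> depending on
finitely many graphs.\<close>

lemma prob_edge_markovian_total:
  assumes init: "set_pmf init \<subseteq> graphs n"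
    and Q: "\<And>G H. (\<And>i. i \<le> m \<Longrightarrow> G i = H i) \<Longrightarrow> Q G = Q H"
    and F: "\<And>G H. (\<And>i. i \<le> m \<Longrightarrow> G i = H i) \<Longrightarrow> F G = F H"
    and fin: "finite A" and FA: "\<And>G. G \<in> UNIV \<rightarrow> graphs n \<Longrightarrow> F G \<in> A"
  shows "measure (edge_markovian n p q init) {G \<in> space (edge_markovian n p q init). Q G} =
    (\<Sum>a\<in>A. measure (edge_markovian n p q init)
      {G \<in> space (edge_markovian n p q init). F G = a \<and> Q G})"
proof -
  let ?M = "edge_markovian n p q init"
  interpret prob_space ?M by (rule prob_space_edge_markovian[OF init])
  have "{G \<in> space ?M. Q G} = (\<Union>a\<in>A. {G \<in> space ?M. F G = a \<and> Q G})"
    using FA by (auto simp: space_edge_markovian[OF init])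
  moreover have "measure ?M \<dots> = (\<Sum>a\<in>A. measure ?M {G \<in> space ?M. F G = a \<and> Q G})"
  proof (rule finite_measure_finite_Union[OF fin])
    show "(\<lambda>a. {G \<in> space ?M. F G = a \<and> Q G}) ` A \<subseteq> sets ?M"
    proof (rule image_subsetI)
      fix a
      have "(F G = a \<and> Q G) = (F H = a \<and> Q H)" if "\<And>i. i \<le> m \<Longrightarrow> G i = H i" for G H
        using Q[OF that] F[OF that] by simp
      then show "{G \<in> space ?M. F G = a \<and> Q G} \<in> sets ?M"
        by (rule sets_edge_markovian_prefix[OF init])
    qed
  qed (auto simp: disjoint_family_on_def)
  ultimately show ?thesis by simp
qed

text \<open>The Markov property for two consecutive times, obtained from the path probabilities
\<open>measure_edge_markovian\<close> by summing over the graphs before time \<open>t\<close>.\<close>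

lemma prob_edge_markovian_Suc:
  assumes init: "set_pmf init \<subseteq> graphs n" and E: "E \<in> graphs n" and E': "E' \<in> graphs n"
  shows "\<P>(G in edge_markovian n p q init. G t = E \<and> G (Suc t) = E') =
    \<P>(G in edge_markovian n p q init. G t = E) * pmf (edge_markovian_step n p q E) E'"
proof -
  let ?M = "edge_markovian n p q init"
  let ?A = "PiE {..<t} (\<lambda>_. graphs n)"
  let ?F = "\<lambda>G. restrict G {..<t}"
  have fin: "finite ?A" by (intro finite_PiE finite_graphs) auto
  have path: "\<P>(G in ?M. ?F G = h \<and> G t = E \<and> G (Suc t) = E') =
      \<P>(G in ?M. ?F G = h \<and> G t = E) * pmf (edge_markovian_step n p q E) E'" if h: "h \<in> ?A" for h
  proof -
    define g where "g = (\<lambda>i. if i < t then h i else if i = t then E else E')"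
    have g: "g i \<in> graphs n" for i using h E E' by (auto simp: g_def)
    have Fh: "?F G = h \<longleftrightarrow> (\<forall>i<t. G i = g i)" for G
      using h by (auto simp: fun_eq_iff g_def PiE_def extensional_def)
    have gt: "g t = E" "g (Suc t) = E'" by (simp_all add: g_def)
    have upto_t: "(\<forall>i\<le>t. P i) \<longleftrightarrow> (\<forall>i<t. P i) \<and> P t" for P
      by (auto simp: le_less)
    have upto_Suc_t: "(\<forall>i\<le>Suc t. P i) \<longleftrightarrow> (\<forall>i\<le>t. P i) \<and> P (Suc t)" for P
      by (auto simp: le_Suc_eq)
    have "(?F G = h \<and> G t = E) \<longleftrightarrow> (\<forall>i\<le>t. G i = g i)" for G
      unfolding Fh upto_t gt by (rule refl)
    moreover have "(?F G = h \<and> G t = E \<and> G (Suc t) = E') \<longleftrightarrow> (\<forall>i\<le>Suc t. G i = g i)" for G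
      unfolding Fh upto_Suc_t upto_t gt by (simp only: conj_assoc)
    ultimately show ?thesis
      using g by (simp only: measure_edge_markovian[OF init]) (simp add: g_def)
  qed
  have "\<P>(G in ?M. G t = E \<and> G (Suc t) = E') =
      (\<Sum>h\<in>?A. \<P>(G in ?M. ?F G = h \<and> G t = E \<and> G (Suc t) = E'))"
  proof (rule prob_edge_markovian_total[OF init, where m = "Suc t" and F = ?F])
    fix G H :: "nat \<Rightarrow> nat set set" assume eq: "\<And>i. i \<le> Suc t \<Longrightarrow> G i = H i"
    show "(G t = E \<and> G (Suc t) = E') = (H t = E \<and> H (Suc t) = E')"
      using eq[of t] eq[of "Suc t"] by simp
    show "?F G = ?F H" by (rule restrict_ext) (use eq in simp)
  qed (use fin in auto)
  also have "\<dots> = (\<Sum>h\<in>?A. \<P>(G in ?M. ?F G = h \<and> G t = E)) * pmf (edge_markovian_step n p q E) E'"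
    by (simp add: path sum_distrib_right cong: sum.cong)
  also have "(\<Sum>h\<in>?A. \<P>(G in ?M. ?F G = h \<and> G t = E)) = \<P>(G in ?M. G t = E)"
  proof (rule prob_edge_markovian_total[OF init, where m = t and F = ?F, symmetric])
    fix G H :: "nat \<Rightarrow> nat set set" assume eq: "\<And>i. i \<le> t \<Longrightarrow> G i = H i"
    show "(G t = E) = (H t = E)" using eq[of t] by simp
    show "?F G = ?F H" by (rule restrict_ext) (use eq in simp)
  qed (use fin in auto)
  finally show ?thesis .
qed

lemma edge_markovian_marginal:
  assumes init: "set_pmf init \<subseteq> graphs n"
    and stat: "bind_pmf init (edge_markovian_step n p q) = init"
    and E: "E \<in> graphs n"
  shows "\<P>(G in edge_markovian n p q init. G t = E) = pmf init E"
  using E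
proof (induction t arbitrary: E)
  case 0
  then show ?case using measure_edge_markovian[OF init, of "\<lambda>_. E" p q 0] by simp
next
  case (Suc t)
  let ?M = "edge_markovian n p q init"
  have "\<P>(G in ?M. G (Suc t) = E) = (\<Sum>E'\<in>graphs n. \<P>(G in ?M. G t = E' \<and> G (Suc t) = E))"
    by (rule prob_edge_markovian_total[OF init, where m = "Suc t" and F = "\<lambda>G. G t"])
       (auto simp: finite_graphs)
  also have "\<dots> = (\<Sum>E'\<in>graphs n. pmf init E' * pmf (edge_markovian_step n p q E') E)"
    by (intro sum.cong refl) (simp add: prob_edge_markovian_Suc[OF init] Suc)
  also have "\<dots> = pmf (bind_pmf init (edge_markovian_step n p q)) E"
    unfolding pmf_bind using init by (subst integral_measure_pmf[OF finite_graphs]) auto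
  finally show ?case by (simp add: stat)
qed

lemma prob_edge_markovian_at:
  assumes init: "set_pmf init \<subseteq> graphs n"
    and stat: "bind_pmf init (edge_markovian_step n p q) = init"
  shows "\<P>(G in edge_markovian n p q init. B (G t)) = measure_pmf.prob init {E. B E}"
proof -
  let ?M = "edge_markovian n p q init"
  have "\<P>(G in ?M. B (G t)) = (\<Sum>E\<in>graphs n. \<P>(G in ?M. G t = E \<and> B (G t)))"
    by (rule prob_edge_markovian_total[OF init, where m = t and F = "\<lambda>G. G t"])
       (auto simp: finite_graphs)
  also have "\<dots> = (\<Sum>E\<in>graphs n. if B E then pmf init E else 0)"
  proof (intro sum.cong refl)
    fix E assume "E \<in> graphs n"
    moreover have "{G \<in> space ?M. G t = E \<and> B (G t)} =
        (if B E then {G \<in> space ?M. G t = E} else {})" by auto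
    ultimately show "\<P>(G in ?M. G t = E \<and> B (G t)) = (if B E then pmf init E else 0)"
      by (simp add: edge_markovian_marginal[OF init stat])
  qed
  also have "\<dots> = (\<Sum>E\<in>{E \<in> graphs n. B E}. pmf init E)"
    by (simp add: sum.inter_filter finite_graphs)
  also have "\<dots> = measure_pmf.prob init {E \<in> graphs n. B E}"
    by (rule measure_measure_pmf_finite[symmetric]) (simp add: finite_graphs)
  also have "\<dots> = measure_pmf.prob init {E. B E}"
    by (rule measure_pmf.finite_measure_eq_AE) (use init in \<open>auto simp: AE_measure_pmf_iff\<close>)
  finally show ?thesis .
qed

section \<open>Contraction of the lazy walk on a well-spread graph\<close>

text \<open>The parameter \<open>d\<close> stands for \<open>n r\<close> in a random graph of edge density \<open>r\<close>. The constant \<open>2 ^ 20\<close> is chosen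
together with the splitting ratio \<open>2 ^ 9\<close> of the level-set bound: with maximal degree \<open>4 * d\<close> the coefficient
there is \<open>4 * d / 2 ^ 9 + 8 * (d / 2 ^ 20) * 2 ^ 9 = 3 * d / 256\<close>, which is below \<open>d / 40\<close>, a quarter of the
minimal degree.\<close>

definition well_spread :: "nat \<Rightarrow> real \<Rightarrow> real \<Rightarrow> nat set set \<Rightarrow> bool" where
  "well_spread n d C E \<longleftrightarrow>
     (\<forall>x\<in>{1..n}. d / 10 \<le> real (vertex_degree E x) \<and> real (vertex_degree E x) \<le> 4 * d) \<and>
     (\<forall>S T. S \<subseteq> {1..n} \<longrightarrow> T \<subseteq> {1..n} \<longrightarrow>
        edges_between E S T \<le> C * (d / n) * (card S * card T) + d / 2 ^ 20 * (card S + card T))"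

abbreviation adj :: "nat set set \<Rightarrow> nat \<Rightarrow> nat \<Rightarrow> real" where
  "adj E x y \<equiv> of_bool ({x, y} \<in> E)"

lemma adj_row_sum:
  assumes "E \<in> graphs n" and "x \<in> {1..n}"
  shows "(\<Sum>y\<in>{1..n}. adj E x y) = vertex_degree E x"
  by (simp add: vertex_degree_eq_card_neighbours[OF assms] Int_def)

lemma edges_between_eq_adj_sum:
  assumes "finite S" and "finite T"
  shows "real (edges_between E S T) = (\<Sum>x\<in>S. \<Sum>y\<in>T. adj E x y)"
proof -
  have "(\<Sum>x\<in>S. \<Sum>y\<in>T. adj E x y) = (\<Sum>p\<in>S \<times> T. of_bool ({fst p, snd p} \<in> E))"
    by (simp add: sum.cartesian_product case_prod_unfold)
  also have "\<dots> = card {p \<in> S \<times> T. {fst p, snd p} \<in> E}"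
    using assms by (simp add: Int_def)
  finally show ?thesis by (simp add: edges_between_def case_prod_unfold mem_Times_iff)
qed

lemma lazy_walk_eq:
  assumes "E \<in> graphs n"
  shows "lazy_walk E x y = (if x = y then if vertex_degree E x = 0 then 1 else 1 / 2 else 0)
    + adj E x y / (2 * vertex_degree E x)"
proof -
  have "{z} \<notin> E" for z using assms by (auto simp: graphs_def vertex_pairs_def)
  then show ?thesis by (simp add: lazy_walk_def)
qed

text \<open>At an isolated vertex the division by zero makes the adjacency term vanish, matching the holding
probability 1.\<close>

lemma lazy_walk_row_sum:
  assumes "E \<in> graphs n" and "x \<in> {1..n}"
  shows "(\<Sum>y\<in>{1..n}. lazy_walk E x y) = 1"
proof -
  have "(\<Sum>y\<in>{1..n}. lazy_walk E x y) =
      (if vertex_degree E x = 0 then 1 else 1 / 2) + vertex_degree E x / (2 * vertex_degree E x)"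
    unfolding lazy_walk_eq[OF assms(1)] sum.distrib sum_divide_distrib[symmetric] adj_row_sum[OF assms]
    using assms(2) by simp
  then show ?thesis by simp
qed

lemma walk_dist_nonneg:
  assumes "\<And>x. 0 \<le> \<mu>\<^sub>0 x"
  shows "0 \<le> walk_dist n G \<mu>\<^sub>0 t x"
proof (induction t arbitrary: x)
  case (Suc t)
  have "0 \<le> lazy_walk E y x" for E y by (simp add: lazy_walk_def)
  with Suc show ?case by (auto intro!: sum_nonneg)
qed (use assms in simp)

lemma walk_dist_sum:
  assumes "(\<Sum>x\<in>{1..n}. \<mu>\<^sub>0 x) = 1" and "\<And>s. G s \<in> graphs n"
  shows "(\<Sum>x\<in>{1..n}. walk_dist n G \<mu>\<^sub>0 t x) = 1"
proof (induction t)
  case (Suc t)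
  have "(\<Sum>y\<in>{1..n}. walk_dist n G \<mu>\<^sub>0 (Suc t) y) =
      (\<Sum>x\<in>{1..n}. walk_dist n G \<mu>\<^sub>0 t x * (\<Sum>y\<in>{1..n}. lazy_walk (G (Suc t)) x y))"
    by (simp add: sum_distrib_left) (rule sum.swap)
  also have "\<dots> = (\<Sum>x\<in>{1..n}. walk_dist n G \<mu>\<^sub>0 t x)"
    by (intro sum.cong refl) (simp only: lazy_walk_row_sum[OF assms(2)] mult_1_right)
  also have "\<dots> = 1" by (rule Suc)
  finally show ?case .
qed (use assms in simp)

text \<open>With \<open>f = \<mu> / deg\<close> and \<open>h = A f\<close>, the new distribution is \<open>(\<mu> + h) / 2\<close>, so by convexity it is enough to bound
\<open>H = \<Sum>h\<^sup>2\<close>. This is the bilinear form of \<open>A\<close> at \<open>f\<close> and \<open>h\<close>. The mass of \<open>h\<close> is 1, because each vertex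
spreads its mass evenly over its neighbours, and the minimal degree bounds the mass and the energy of \<open>f\<close>
by \<open>10 / d\<close> and \<open>100 / d\<^sup>2\<close> times those of \<open>\<mu>\<close>.\<close>

lemma lazy_walk_energy_le:
  fixes \<mu> :: "nat \<Rightarrow> real"
  assumes E: "E \<in> graphs n" and ws: "well_spread n d C E" and d: "d > 0" and C: "C \<ge> 0"
    and nonneg: "\<And>x. 0 \<le> \<mu> x" and sum1: "(\<Sum>x\<in>{1..n}. \<mu> x) = 1"
  shows "(\<Sum>y\<in>{1..n}. (\<Sum>x\<in>{1..n}. \<mu> x * lazy_walk E x y)\<^sup>2)
    \<le> 5 / 8 * (\<Sum>x\<in>{1..n}. (\<mu> x)\<^sup>2) + 40 * C / n"
proof -
  let ?V = "{1..n}"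
  define deg where "deg = (\<lambda>x. real (vertex_degree E x))"
  define f where "f = (\<lambda>x. \<mu> x / deg x)"
  define h where "h = (\<lambda>y. \<Sum>x\<in>?V. f x * adj E x y)"
  define N where "N = (\<Sum>x\<in>?V. (\<mu> x)\<^sup>2)"
  define H where "H = (\<Sum>y\<in>?V. (h y)\<^sup>2)"
  define F where "F = (\<Sum>x\<in>?V. (f x)\<^sup>2)"
  define \<alpha> where "\<alpha> = C * (d / n)"
  have deg: "d / 10 \<le> deg x" "deg x \<le> 4 * d" "deg x > 0" if "x \<in> ?V" for x
    using ws d that by (force simp: well_spread_def deg_def)+
  have f: "0 \<le> f x" "f x \<le> 10 / d * \<mu> x" if "x \<in> ?V" for x
  proof -
    show "0 \<le> f x" using nonneg[of x] by (simp add: f_def deg_def)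
    have "\<mu> x / deg x \<le> \<mu> x / (d / 10)"
      using deg[OF that] d nonneg[of x] by (intro divide_left_mono) auto
    then show "f x \<le> 10 / d * \<mu> x" by (simp add: f_def mult.commute)
  qed
  have h: "0 \<le> h y" for y
    unfolding h_def by (intro sum_nonneg mult_nonneg_nonneg f(1)) auto

  have noloop: "{z} \<notin> E" for z using E by (auto simp: graphs_def vertex_pairs_def)
  have step: "(\<Sum>x\<in>?V. \<mu> x * lazy_walk E x y) = \<mu> y / 2 + h y / 2" if y: "y \<in> ?V" for y
  proof -
    have "\<mu> x * lazy_walk E x y = (if x = y then \<mu> x / 2 else 0) + f x * adj E x y / 2"
      if "x \<in> ?V" for x
      using deg(3)[OF that]
      by (cases "x = y") (auto simp: lazy_walk_eq[OF E] noloop deg_def f_def)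
    then have "(\<Sum>x\<in>?V. \<mu> x * lazy_walk E x y) =
        (\<Sum>x\<in>?V. (if x = y then \<mu> x / 2 else 0) + f x * adj E x y / 2)"
      by (rule sum.cong[OF refl])
    also have "\<dots> = \<mu> y / 2 + h y / 2"
      unfolding h_def sum_divide_distrib sum.distrib using y by simp
    finally show ?thesis .
  qed
  have mass_h: "(\<Sum>y\<in>?V. h y) = 1"
  proof -
    have "(\<Sum>y\<in>?V. h y) = (\<Sum>x\<in>?V. f x * (\<Sum>y\<in>?V. adj E x y))"
      unfolding h_def sum_distrib_left by (rule sum.swap)
    also have "\<dots> = (\<Sum>x\<in>?V. \<mu> x)"
    proof (rule sum.cong[OF refl])
      fix x assume x: "x \<in> ?V"
      show "f x * (\<Sum>y\<in>?V. adj E x y) = \<mu> x"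
        unfolding adj_row_sum[OF E x] using deg(3)[OF x] by (simp add: f_def deg_def)
    qed
    finally show ?thesis using sum1 by simp
  qed
  have mass_f: "(\<Sum>x\<in>?V. f x) \<le> 10 / d"
  proof -
    have "(\<Sum>x\<in>?V. f x) \<le> (\<Sum>x\<in>?V. 10 / d * \<mu> x)" by (intro sum_mono f(2))
    then show ?thesis using sum1 by (simp add: sum_distrib_left[symmetric] del: times_divide_eq_left)
  qed
  have energy_f: "F \<le> 100 / d\<^sup>2 * N"
  proof -
    have "F \<le> (\<Sum>x\<in>?V. (10 / d * \<mu> x)\<^sup>2)"
      unfolding F_def by (intro sum_mono power_mono f)
    also have "\<dots> = 100 / d\<^sup>2 * N"
      unfolding N_def sum_distrib_left by (intro sum.cong) (auto simp: power2_eq_square)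
    finally show ?thesis .
  qed

  \<comment> \<open>The level-set bound is applied to \<open>f\<close> and \<open>\<tau> h\<close>. This
    \<open>\<tau>\<close> makes the term \<open>d / 40 * \<tau>\<^sup>2 * H\<close> half of the left-hand
    side \<open>\<tau> * H\<close>, so that it can be absorbed.\<close>
  define \<tau> where "\<tau> = 20 / d"
  have \<tau>: "\<tau> > 0" using d by (simp add: \<tau>_def)
  have "(\<Sum>x\<in>?V. \<Sum>y\<in>?V. f x * (\<tau> * h y) * adj E x y) \<le>
      4 * \<alpha> * (\<Sum>x\<in>?V. f x) * (\<Sum>y\<in>?V. \<tau> * h y)
      + (4 * d / 2 ^ 9 + 8 * (d / 2 ^ 20) * 2 ^ 9) * (F + (\<Sum>y\<in>?V. (\<tau> * h y)\<^sup>2))"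
    unfolding F_def
  proof (rule bilinear_form_le_of_discrepancy)
    show row: "(\<Sum>y\<in>?V. adj E x y) \<le> 4 * d" if "x \<in> ?V" for x
      using deg(2)[OF that] unfolding adj_row_sum[OF E that] by (simp add: deg_def)
    show "(\<Sum>x\<in>?V. adj E x y) \<le> 4 * d" if "y \<in> ?V" for y
      unfolding insert_commute[of _ y] by (rule row[OF that])
    show "(\<Sum>x\<in>S. \<Sum>y\<in>T. adj E x y) \<le>
        \<alpha> * real (card S * card T) + d / 2 ^ 20 * real (card S + card T)"
      if "S \<subseteq> ?V" "T \<subseteq> ?V" for S T
    proof -
      have "finite S" "finite T" using that finite_subset by auto
      then have "(\<Sum>x\<in>S. \<Sum>y\<in>T. adj E x y) = edges_between E S T"
        by (simp only: edges_between_eq_adj_sum)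
      then show ?thesis using ws that unfolding well_spread_def \<alpha>_def by metis
    qed
  qed (use f(1) h \<tau> C d in \<open>auto simp: \<alpha>_def\<close>)
  also have "(\<Sum>x\<in>?V. \<Sum>y\<in>?V. f x * (\<tau> * h y) * adj E x y) = \<tau> * H"
  proof -
    have "(\<Sum>x\<in>?V. f x * (\<tau> * c) * adj E x y) = \<tau> * (c * h y)" for c y
      unfolding h_def sum_distrib_left by (intro sum.cong refl) (simp only: mult_ac)
    then show ?thesis
      unfolding H_def power2_eq_square by (subst sum.swap) (simp only: sum_distrib_left)
  qed
  also have "4 * \<alpha> * (\<Sum>x\<in>?V. f x) * (\<Sum>y\<in>?V. \<tau> * h y) = 4 * \<alpha> * \<tau> * (\<Sum>x\<in>?V. f x)"
    using mass_h by (simp add: sum_distrib_left[symmetric])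
  also have "(\<Sum>y\<in>?V. (\<tau> * h y)\<^sup>2) = \<tau>\<^sup>2 * H"
    by (simp add: H_def power_mult_distrib sum_distrib_left)
  also have "4 * \<alpha> * \<tau> * (\<Sum>x\<in>?V. f x) \<le> 4 * \<alpha> * \<tau> * (10 / d)"
    using mass_f \<tau> C d by (intro mult_left_mono) (auto simp: \<alpha>_def)
  also have "(4 * d / 2 ^ 9 + 8 * (d / 2 ^ 20) * 2 ^ 9) * (F + \<tau>\<^sup>2 * H) \<le> d / 40 * (F + \<tau>\<^sup>2 * H)"
    using d by (intro mult_right_mono) (auto simp: F_def H_def intro!: add_nonneg_nonneg mult_nonneg_nonneg sum_nonneg)
  finally have bound: "\<tau> * H \<le> 4 * \<alpha> * \<tau> * (10 / d) + d / 40 * (F + \<tau>\<^sup>2 * H)"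
    by simp
  have "\<tau> * H = 20 * (H / d)" by (simp add: \<tau>_def)
  moreover have "4 * \<alpha> * \<tau> * (10 / d) = 800 * (C / n / d)"
    using d by (simp add: \<tau>_def \<alpha>_def)
  moreover have "d / 40 * (F + \<tau>\<^sup>2 * H) = d / 40 * F + 10 * (H / d)"
    using d by (simp add: \<tau>_def distrib_left power2_eq_square)
  ultimately have "20 * (H / d) \<le> 800 * (C / n / d) + (d / 40 * F + 10 * (H / d))"
    using bound by (simp only:)
  moreover have "d / 40 * F \<le> 5 / 2 * (N / d)"
  proof -
    have "d / 40 * F \<le> d / 40 * (100 / d\<^sup>2 * N)"
      using d energy_f by (intro mult_left_mono) auto
    also have "\<dots> = 5 / 2 * (N / d)" using d by (simp add: power2_eq_square)
    finally show ?thesis .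
  qed
  moreover have "h \<le> 80 * c + m / 4" if "20 * h \<le> 800 * c + (k + 10 * h)" "k \<le> 5 / 2 * m"
    for h c k m :: real using that by linarith
  ultimately have "H / d \<le> 80 * (C / n / d) + N / d / 4" by blast
  also have "\<dots> = (80 * C / n + N / 4) / d" by (simp add: add_divide_distrib)
  finally have H: "H \<le> 80 * C / n + N / 4"
    using d by (simp add: divide_le_cancel)

  have "(\<Sum>y\<in>?V. (\<Sum>x\<in>?V. \<mu> x * lazy_walk E x y)\<^sup>2) = (\<Sum>y\<in>?V. (\<mu> y / 2 + h y / 2)\<^sup>2)"
    by (intro sum.cong refl) (simp only: step)
  also have "\<dots> \<le> (\<Sum>y\<in>?V. (\<mu> y)\<^sup>2 / 2 + (h y)\<^sup>2 / 2)"
  proof (rule sum_mono)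
    fix y
    have "0 \<le> (\<mu> y - h y)\<^sup>2" by simp
    then show "(\<mu> y / 2 + h y / 2)\<^sup>2 \<le> (\<mu> y)\<^sup>2 / 2 + (h y)\<^sup>2 / 2"
      by (simp add: power2_eq_square algebra_simps)
  qed
  also have "\<dots> = N / 2 + H / 2"
    by (simp add: sum.distrib N_def H_def sum_divide_distrib)
  finally show ?thesis using H unfolding N_def by simp
qed

text \<open>The energy recursion started at time \<open>m\<close> from the trivial bound 1. The value 107 is a constant \<open>b\<close> with
\<open>5 / 8 * b + 40 \<le> b\<close>.\<close>

lemma walk_dist_energy_le:
  assumes C: "C \<ge> 0" and d: "d > 0" and nonneg: "\<And>x. 0 \<le> \<mu>\<^sub>0 x" and sum1: "(\<Sum>x\<in>{1..n}. \<mu>\<^sub>0 x) = 1"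
    and G: "\<And>s. G s \<in> graphs n"
    and ws: "\<And>s. m < s \<Longrightarrow> s \<le> m + k \<Longrightarrow> well_spread n d C (G s)"
  shows "(\<Sum>x\<in>{1..n}. (walk_dist n G \<mu>\<^sub>0 (m + k) x)\<^sup>2) \<le> (5 / 8) ^ k + 107 * C / n"
  using ws
proof (induction k)
  case 0
  have le1: "walk_dist n G \<mu>\<^sub>0 m x \<le> 1" if "x \<in> {1..n}" for x
    using member_le_sum[of x "{1..n}" "walk_dist n G \<mu>\<^sub>0 m"] that walk_dist_nonneg[OF nonneg]
      walk_dist_sum[OF sum1 G, where t = m] by simp
  have "(\<Sum>x\<in>{1..n}. (walk_dist n G \<mu>\<^sub>0 m x)\<^sup>2) \<le> (\<Sum>x\<in>{1..n}. walk_dist n G \<mu>\<^sub>0 m x)"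
    unfolding power2_eq_square
    by (intro sum_mono mult_left_le le1 walk_dist_nonneg nonneg)
  also have "\<dots> \<le> 1 + 107 * C / n" using walk_dist_sum[OF sum1 G, where t = m] C by simp
  finally show ?case by simp
next
  case (Suc k)
  have "(\<Sum>x\<in>{1..n}. (walk_dist n G \<mu>\<^sub>0 (m + Suc k) x)\<^sup>2) \<le>
      5 / 8 * (\<Sum>x\<in>{1..n}. (walk_dist n G \<mu>\<^sub>0 (m + k) x)\<^sup>2) + 40 * C / n"
    unfolding add_Suc_right walk_dist.simps
    by (rule lazy_walk_energy_le[OF G _ d C])
       (use Suc.prems walk_dist_nonneg[OF nonneg] walk_dist_sum[OF sum1 G] in auto)
  also have "\<dots> \<le> 5 / 8 * ((5 / 8) ^ k + 107 * C / n) + 40 * C / n"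
    using Suc by simp
  also have "\<dots> = (5 / 8) ^ Suc k + 855 / 8 * (C / n)"
    by (simp add: distrib_left)
  also have "\<dots> \<le> (5 / 8) ^ Suc k + 107 * (C / n)"
    using C by (intro add_left_mono mult_right_mono) auto
  also have "\<dots> = (5 / 8) ^ Suc k + 107 * C / n" by simp
  finally show ?case .
qed

lemma sum_vertex_degree:
  assumes E: "E \<in> graphs n"
  shows "(\<Sum>x\<in>{1..n}. real (vertex_degree E x)) = 2 * card E"
proof -
  have "(\<Sum>x\<in>{1..n}. real (vertex_degree E x)) = (\<Sum>e\<in>E. \<Sum>x\<in>{1..n}. of_bool (x \<in> e))"
    unfolding vertex_degree_eq_sum[OF E] by (rule sum.swap)
  also have "\<dots> = (\<Sum>e\<in>E. 2)"
  proof (rule sum.cong[OF refl])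
    fix e assume "e \<in> E"
    then obtain u v where "e = {u, v}" "u \<in> {1..n}" "v \<in> {1..n}" "u \<noteq> v"
      using E unfolding graphs_def vertex_pairs_def by blast
    then have "{1..n} \<inter> {x. x \<in> e} = {u, v}" "u \<noteq> v" by auto
    then show "(\<Sum>x\<in>{1..n}. of_bool (x \<in> e)) = (2 :: real)" by simp
  qed
  finally show ?thesis by simp
qed

text \<open>Expanding the square, the quantity in \<open>well_mixed\<close> equals \<open>(\<Sum>x. \<mu> x\<^sup>2 / \<pi> x) - 1\<close>. The degree bounds at the
final time give \<open>\<pi> x \<ge> 1 / (40 n)\<close>, which reduces it to the energy.\<close>

lemma well_mixed_of_well_spread:
  assumes C: "C \<ge> 0" and d: "d > 0" and n: "n > 0"
    and nonneg: "\<And>x. 0 \<le> \<mu>\<^sub>0 x" and sum1: "(\<Sum>x\<in>{1..n}. \<mu>\<^sub>0 x) = 1"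
    and G: "\<And>s. G s \<in> graphs n"
    and ws: "\<And>s. m < s \<Longrightarrow> s \<le> m + k \<Longrightarrow> well_spread n d C (G s)"
    and k: "k > 0" "(5 / 8) ^ k \<le> 1 / real n"
  shows "well_mixed n G \<mu>\<^sub>0 (m + k) (40 * (1 + 107 * C))"
proof -
  let ?V = "{1..n}"
  define \<mu> where "\<mu> = walk_dist n G \<mu>\<^sub>0 (m + k)"
  define E where "E = G (m + k)"
  define \<pi> where "\<pi> = stationary E"
  have E: "E \<in> graphs n" and wsE: "well_spread n d C E"
    using G ws k by (auto simp: E_def)
  have deg: "d / 10 \<le> real (vertex_degree E x)" "real (vertex_degree E x) \<le> 4 * d" if "x \<in> ?V" for x
    using wsE that by (auto simp: well_spread_def)
  have edges: "2 * real (card E) \<le> 4 * d * n" "2 * real (card E) > 0"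
  proof -
    have "(\<Sum>x\<in>?V. real (vertex_degree E x)) \<le> of_nat (card ?V) * (4 * d)"
      by (intro sum_bounded_above deg)
    then show "2 * real (card E) \<le> 4 * d * n"
      unfolding sum_vertex_degree[OF E] by (simp add: mult_ac)
    have "(\<Sum>x\<in>?V. real (vertex_degree E x)) \<ge> of_nat (card ?V) * (d / 10)"
      by (intro sum_bounded_below deg)
    moreover have "of_nat (card ?V) * (d / 10) > 0" using d n by simp
    ultimately show "2 * real (card E) > 0" unfolding sum_vertex_degree[OF E] by linarith
  qed
  have \<pi>: "\<pi> x \<ge> 1 / (40 * n)" if "x \<in> ?V" for x
  proof -
    have "1 / (40 * n) = (d / 10) / (4 * d * n)" using d n by (simp add: field_simps)
    also have "\<dots> \<le> vertex_degree E x / (2 * card E)"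
      using d n edges deg[OF that] by (intro frac_le) auto
    finally show ?thesis by (simp add: \<pi>_def stationary_def)
  qed
  have \<pi>pos: "\<pi> x > 0" if "x \<in> ?V" for x
    using \<pi>[OF that] n by (intro less_le_trans[OF _ \<pi>[OF that]]) simp
  have \<pi>sum: "(\<Sum>x\<in>?V. \<pi> x) = 1"
    using edges(2)
    unfolding \<pi>_def stationary_def sum_divide_distrib[symmetric] sum_vertex_degree[OF E] by simp
  have \<mu>sum: "(\<Sum>x\<in>?V. \<mu> x) = 1" unfolding \<mu>_def by (rule walk_dist_sum[OF sum1 G])
  have energy: "(\<Sum>x\<in>?V. (\<mu> x)\<^sup>2) \<le> (1 + 107 * C) / n"
  proof -
    have "(\<Sum>x\<in>?V. (\<mu> x)\<^sup>2) \<le> (5 / 8) ^ k + 107 * C / n"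
      unfolding \<mu>_def by (rule walk_dist_energy_le[OF C d nonneg sum1]) (use G ws in auto)
    then show ?thesis using k(2) by (simp add: add_divide_distrib)
  qed
  have "(\<Sum>x\<in>?V. (\<mu> x / \<pi> x - 1)\<^sup>2 * \<pi> x) = (\<Sum>x\<in>?V. (\<mu> x)\<^sup>2 / \<pi> x - 2 * \<mu> x + \<pi> x)"
  proof (rule sum.cong[OF refl])
    fix x assume "x \<in> ?V"
    then show "(\<mu> x / \<pi> x - 1)\<^sup>2 * \<pi> x = (\<mu> x)\<^sup>2 / \<pi> x - 2 * \<mu> x + \<pi> x"
      using \<pi>pos[of x] by (simp add: field_simps power2_eq_square)
  qed
  also have "\<dots> = (\<Sum>x\<in>?V. (\<mu> x)\<^sup>2 / \<pi> x) - 1"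
    unfolding sum.distrib sum_subtractf sum_distrib_left[symmetric] \<pi>sum \<mu>sum by simp
  also have "\<dots> \<le> (\<Sum>x\<in>?V. 40 * n * (\<mu> x)\<^sup>2)"
  proof -
    have "(\<mu> x)\<^sup>2 / \<pi> x \<le> 40 * n * (\<mu> x)\<^sup>2" if "x \<in> ?V" for x
    proof -
      have "(\<mu> x)\<^sup>2 / \<pi> x \<le> (\<mu> x)\<^sup>2 / (1 / (40 * n))"
        using \<pi>[OF that] \<pi>pos[OF that] n by (intro divide_left_mono) auto
      then show ?thesis by (simp add: mult_ac)
    qed
    then have "(\<Sum>x\<in>?V. (\<mu> x)\<^sup>2 / \<pi> x) \<le> (\<Sum>x\<in>?V. 40 * n * (\<mu> x)\<^sup>2)" by (rule sum_mono)
    then show ?thesis by linarith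
  qed
  also have "\<dots> = 40 * n * (\<Sum>x\<in>?V. (\<mu> x)\<^sup>2)" by (simp only: sum_distrib_left)
  also have "\<dots> \<le> 40 * n * ((1 + 107 * C) / n)" by (intro mult_left_mono energy) simp
  also have "\<dots> = 40 * (1 + 107 * C)" using n by simp
  finally have chi: "(\<Sum>x\<in>?V. (\<mu> x / \<pi> x - 1)\<^sup>2 * \<pi> x) \<le> 40 * (1 + 107 * C)" .
  have "(weighted_norm2 n \<pi> (\<lambda>x. \<mu> x / \<pi> x - 1))\<^sup>2 = (\<Sum>x\<in>?V. (\<mu> x / \<pi> x - 1)\<^sup>2 * \<pi> x)"
    unfolding weighted_norm2_def
    by (rule real_sqrt_pow2) (auto intro!: sum_nonneg simp: less_imp_le[OF \<pi>pos])
  then show ?thesis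
    using chi \<pi>pos by (auto simp: well_mixed_def \<mu>_def \<pi>_def E_def less_le)
qed

section \<open>The random graph is well spread\<close>

text \<open>This is \<open>(exp (2 \<lambda>) - 1) / \<lambda>\<close> for \<open>\<lambda> = 3 * 2 ^ 19\<close>: multiplied by \<open>\<lambda>\<close> it cancels the exponential moment in
\<open>erdos_renyi_edges_between_tail\<close>. The value of \<open>\<lambda>\<close> is chosen so that \<open>\<lambda> / 2 ^ 20 = 3 / 2\<close>, which with
\<open>d \<ge> 2 ln n\<close> leaves the tail \<open>exp (- 3 ln n (|S| + |T|))\<close>.\<close>

definition discrepancy_const :: real where
  "discrepancy_const = (exp (2 * (3 * 2 ^ 19)) - 1) / (3 * 2 ^ 19)"

lemma discrepancy_const_nonneg: "discrepancy_const \<ge> 0"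
  by (simp add: discrepancy_const_def)

text \<open>The three summands are the union bounds for too small degrees, too large degrees, and too many edges
between two sets. The first is \<open>n powr (- 1 / 5)\<close>, the largest of the three. In the third, summing \<open>y ^ (|S| + |T|)\<close>
with \<open>y = exp (- 3 ln n)\<close> over all pairs other than the empty one gives \<open>(1 + y) ^ (2 n) - 1\<close>.\<close>

lemma not_well_spread_prob_le:
  fixes r :: real
  assumes r: "0 \<le> r" "r \<le> 1" and n: "n \<ge> 40" and dense: "2 * ln n \<le> n * r"
  shows "measure_pmf.prob (erdos_renyi n r) {E. \<not> well_spread n (n * r) discrepancy_const E} \<le>
    n * exp (- (6 / 5 * ln n)) + n * exp (- (4 * ln n)) + (exp (2 * real n * exp (- (3 * ln n))) - 1)"
proof -
  let ?V = "{1..n}"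
  let ?P = "measure_pmf.prob (erdos_renyi n r)"
  define d where "d = n * r"
  define l :: real where "l = 3 * 2 ^ 19"
  define y where "y = exp (- (3 * ln n))"
  define thr where "thr = (\<lambda>(S :: nat set) (T :: nat set). discrepancy_const * r * (card S * card T) + d / 2 ^ 20 * (card S + card T))"
  define Lo where "Lo = (\<lambda>x. {E. -2 * real (vertex_degree E x) \<ge> -2 * (d / 10)})"
  define Up where "Up = (\<lambda>x. {E. 1 * real (vertex_degree E x) \<ge> 4 * d})"
  define Di where "Di = (\<lambda>p. {E. l * edges_between E (fst p) (snd p) \<ge> l * thr (fst p) (snd p)})"
  define Ps where "Ps = Pow ?V \<times> Pow ?V - {({}, {})}"
  have d: "d \<ge> 2 * ln n" and d0: "d \<ge> 0" using dense r by (simp_all add: d_def)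
  have l: "l > 0" by (simp add: l_def)
  have dn: "d / n = r" using n by (simp add: d_def)
  have finPs: "finite Ps" by (simp add: Ps_def)

  have "{E. \<not> well_spread n d discrepancy_const E} \<subseteq> (\<Union>x\<in>?V. Lo x) \<union> (\<Union>x\<in>?V. Up x) \<union> (\<Union>p\<in>Ps. Di p)"
  proof
    fix E assume "E \<in> {E. \<not> well_spread n d discrepancy_const E}"
    then consider x where "x \<in> ?V" "vertex_degree E x < d / 10"
      | x where "x \<in> ?V" "vertex_degree E x > 4 * d"
      | S T where "S \<subseteq> ?V" "T \<subseteq> ?V" "edges_between E S T > thr S T"
      unfolding well_spread_def thr_def dn mem_Collect_eq not_le[symmetric] by blast
    then show "E \<in> (\<Union>x\<in>?V. Lo x) \<union> (\<Union>x\<in>?V. Up x) \<union> (\<Union>p\<in>Ps. Di p)"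
    proof cases
      case 1
      then show ?thesis by (force simp: Lo_def)
    next
      case 2
      then show ?thesis by (force simp: Up_def)
    next
      case 3
      then have "(S, T) \<in> Ps" by (auto simp: Ps_def thr_def edges_between_def)
      moreover have "E \<in> Di (S, T)" using 3 l by (simp add: Di_def)
      ultimately show ?thesis by blast
    qed
  qed
  then have "?P {E. \<not> well_spread n d discrepancy_const E} \<le>
      ?P ((\<Union>x\<in>?V. Lo x) \<union> (\<Union>x\<in>?V. Up x) \<union> (\<Union>p\<in>Ps. Di p))"
    by (intro measure_pmf.finite_measure_mono) auto
  also have "\<dots> \<le> ?P (\<Union>x\<in>?V. Lo x) + ?P (\<Union>x\<in>?V. Up x) + ?P (\<Union>p\<in>Ps. Di p)"
    by (intro order_trans[OF measure_Un_le] add_right_mono measure_Un_le) auto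
  also have "\<dots> \<le> (\<Sum>x\<in>?V. ?P (Lo x)) + (\<Sum>x\<in>?V. ?P (Up x)) + (\<Sum>p\<in>Ps. ?P (Di p))"
    using finPs by (intro add_mono measure_UNION_le) auto
  also have "(\<Sum>x\<in>?V. ?P (Lo x)) \<le> (\<Sum>x\<in>?V. exp (- (6 / 5 * ln n)))"
  proof (rule sum_mono)
    fix x assume x: "x \<in> ?V"
    have "?P (Lo x) \<le> exp (r * (real n - 1) * (exp (- 2) - 1) - -2 * (d / 10))"
      unfolding Lo_def by (rule erdos_renyi_degree_tail[OF r x])
    also have "\<dots> \<le> exp (- (6 / 5 * ln n))"
    proof -
      \<comment> \<open>Lower tail at \<open>l = - 2\<close>: the exponent is at most \<open>- (39 / 40 *
        21 / 25 - 1 / 5) * d\<close>, below \<open>- 3 / 5 * d\<close>; the factor \<open>39 / 40\<close>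
        accounts for \<open>n - 1\<close> instead of \<open>n\<close>.\<close>
      have "(5 / 2 :: real) \<le> exp 1" using exp_lower_Taylor_quadratic[of 1] by simp
      then have "(5 / 2 :: real)\<^sup>2 \<le> (exp 1)\<^sup>2" by (intro power_mono) auto
      then have "25 / 4 \<le> exp (2 :: real)"
        by (simp add: power2_eq_square exp_add[symmetric])
      then have e: "exp (- 2 :: real) - 1 \<le> - (21 / 25)"
        by (simp add: exp_minus field_simps)
      have "r * (real n - 1) = d - d / n" using n by (simp add: d_def field_simps)
      moreover have "d / n \<le> d / 40" using n d0 by (intro divide_left_mono) auto
      ultimately have "r * (real n - 1) \<ge> 39 / 40 * d" by linarith
      then have "r * (real n - 1) * (21 / 25) \<ge> 39 / 40 * d * (21 / 25)"
        by (rule mult_right_mono) simp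
      moreover have "r * (real n - 1) * (exp (- 2) - 1) \<le> r * (real n - 1) * - (21 / 25)"
        using r n by (intro mult_left_mono e) auto
      ultimately show ?thesis using d d0 by simp
    qed
    finally show "?P (Lo x) \<le> exp (- (6 / 5 * ln n))" .
  qed
  also have "(\<Sum>x\<in>?V. ?P (Up x)) \<le> (\<Sum>x\<in>?V. exp (- (4 * ln n)))"
  proof (rule sum_mono)
    fix x assume x: "x \<in> ?V"
    have "?P (Up x) \<le> exp (r * (real n - 1) * (exp 1 - 1) - 4 * d)"
      unfolding Up_def by (rule erdos_renyi_degree_tail[OF r x])
    also have "\<dots> \<le> exp (- (4 * ln n))"
    proof -
      have "r * (real n - 1) * (exp 1 - 1) \<le> d * 2"
        using r n exp_le by (intro mult_mono) (auto simp: d_def algebra_simps)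
      then show ?thesis using d by simp
    qed
    finally show "?P (Up x) \<le> exp (- (4 * ln n))" .
  qed
  also have "(\<Sum>p\<in>Ps. ?P (Di p)) \<le> (\<Sum>p\<in>Ps. y ^ card (fst p) * y ^ card (snd p))"
  proof (rule sum_mono)
    fix p assume "p \<in> Ps"
    then obtain S T where p: "p = (S, T)" "S \<subseteq> ?V" "T \<subseteq> ?V" by (auto simp: Ps_def)
    have "?P (Di p) \<le> exp (r * (card S * card T) * (exp (2 * l) - 1) - l * thr S T)"
      unfolding Di_def p(1) fst_conv snd_conv
      by (rule erdos_renyi_edges_between_tail[OF r _ p(2,3)]) (use l in simp)
    also have "\<dots> = exp (- (3 / 2 * d * (card S + card T)))"
    proof -
      have "l * discrepancy_const = exp (2 * l) - 1"
        by (simp add: discrepancy_const_def l_def)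
      then have "l * (discrepancy_const * r * (card S * card T)) =
          r * (card S * card T) * (exp (2 * l) - 1)"
        by (simp add: mult_ac)
      moreover have "l * (d / 2 ^ 20 * (card S + card T)) = 3 / 2 * d * (card S + card T)"
        by (simp add: l_def)
      ultimately show ?thesis by (simp only: thr_def distrib_left) simp
    qed
    also have "\<dots> \<le> exp (- (3 * ln n * (card S + card T)))"
      unfolding exp_le_cancel_iff neg_le_iff_le by (intro mult_right_mono) (use d in auto)
    also have "\<dots> = y ^ card S * y ^ card T"
      by (simp add: y_def exp_of_nat_mult[symmetric] exp_add[symmetric] algebra_simps)
    finally show "?P (Di p) \<le> y ^ card (fst p) * y ^ card (snd p)" by (simp add: p(1))
  qed
  also have "\<dots> = (\<Sum>p\<in>Pow ?V \<times> Pow ?V. y ^ card (fst p) * y ^ card (snd p)) - 1"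
    unfolding Ps_def by (subst sum_diff) auto
  also have "(\<Sum>p\<in>Pow ?V \<times> Pow ?V. y ^ card (fst p) * y ^ card (snd p)) =
      (\<Sum>S\<in>Pow ?V. y ^ card S) * (\<Sum>T\<in>Pow ?V. y ^ card T)"
    by (simp only: sum_product sum.cartesian_product case_prod_unfold)
  also have "\<dots> = (1 + y) ^ n * (1 + y) ^ n"
    by (simp only: sum_Pow_power_card finite_atLeastAtMost card_atLeastAtMost diff_Suc_1 One_nat_def Suc_diff_le)
      simp
  also have "\<dots> \<le> exp y ^ n * exp y ^ n"
    by (intro mult_mono power_mono exp_ge_add_one_self) (auto simp: y_def add_nonneg_nonneg)
  also have "exp y ^ n * exp y ^ n = exp (2 * real n * y)"
    by (simp add: exp_of_nat_mult[symmetric] exp_add[symmetric])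
  finally show ?thesis by (simp add: y_def d_def)
qed


section \<open>Mixing of the walk\<close>

lemma walk_dist_cong:
  assumes "\<And>i. i \<le> t \<Longrightarrow> G i = H i"
  shows "walk_dist n G \<mu>\<^sub>0 t = walk_dist n H \<mu>\<^sub>0 t"
  using assms by (induction t) auto

lemma well_mixed_cong:
  assumes "\<And>i. i \<le> t \<Longrightarrow> G i = H i"
  shows "well_mixed n G \<mu>\<^sub>0 t c = well_mixed n H \<mu>\<^sub>0 t c"
  using assms walk_dist_cong[OF assms] by (simp add: well_mixed_def)

text \<open>Only the last \<open>L = \<lceil>3 ln n\<rceil>\<close> graphs are asked to be well spread; the distribution at time \<open>t - L\<close> may be
arbitrary. The choice of \<open>L\<close> makes \<open>(5 / 8) ^ L \<le> 1 / n\<close>, since \<open>5 / 8 \<le> exp (- 1 / 3)\<close>.\<close>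

lemma well_mixed_prob_ge:
  fixes p q :: real and \<mu>\<^sub>0 :: "nat pmf"
  defines "r \<equiv> p / (p + q)"
  assumes p: "0 \<le> p" "p \<le> 1" and q: "0 \<le> q" "q \<le> 1"
    and n: "n \<ge> 40" and dense: "r > 2 * ln n / n"
    and \<mu>: "set_pmf \<mu>\<^sub>0 \<subseteq> {1..n}" and t: "3 * ln n \<le> t"
  shows "\<P>(G in edge_markovian n p q (erdos_renyi n r).
      well_mixed n G (pmf \<mu>\<^sub>0) t (40 * (1 + 107 * discrepancy_const))) \<ge>
    1 - (3 * ln n + 1) * (n * exp (- (6 / 5 * ln n)) + n * exp (- (4 * ln n))
          + (exp (2 * real n * exp (- (3 * ln n))) - 1))"
proof -
  let ?C = discrepancy_const
  define \<delta> where "\<delta> = n * exp (- (6 / 5 * ln n)) + n * exp (- (4 * ln n))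
    + (exp (2 * real n * exp (- (3 * ln n))) - 1)"
  define d where "d = n * r"
  define L where "L = nat \<lceil>3 * ln n\<rceil>"
  define m where "m = t - L"
  let ?init = "erdos_renyi n r"
  let ?M = "edge_markovian n p q ?init"
  have lnpos: "ln n > 0" using n by simp
  have d: "2 * ln n < d" using dense n by (simp add: d_def field_simps)
  have dpos: "d > 0" using d lnpos by linarith
  have "r > 0" using dpos n by (simp add: d_def zero_less_mult_iff)
  then have pq: "p + q > 0" using p q by (cases "p + q = 0") (auto simp: r_def)
  then have r: "0 \<le> r" "r \<le> 1" using p q by (auto simp: r_def)
  have init: "set_pmf ?init \<subseteq> graphs n"
    unfolding erdos_renyi_def by (rule set_independent_edges)
  have stat: "bind_pmf ?init (edge_markovian_step n p q) = ?init"
    unfolding r_def by (rule erdos_renyi_stationary[OF p q pq])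
  interpret prob_space ?M by (rule prob_space_edge_markovian[OF init])
  have L: "L > 0" "L \<le> t" "real L \<le> 3 * ln n + 1" "3 * ln n \<le> real L" and mL: "m + L = t"
    using lnpos t unfolding L_def m_def by linarith+
  have decay: "(5 / 8) ^ L \<le> 1 / real n"
  proof -
    have "(5 / 8 :: real) \<le> exp (- (1 / 3))"
    proof -
      have "(5 / 8 :: real) \<le> exp (- (3 / 8))" using exp_ge_add_one_self[of "- (3 / 8)"] by simp
      also have "\<dots> \<le> exp (- (1 / 3))" unfolding exp_le_cancel_iff by simp
      finally show ?thesis .
    qed
    then have "(5 / 8 :: real) ^ L \<le> exp (- (1 / 3)) ^ L" by (intro power_mono) auto
    also have "\<dots> = exp (- (L / 3))" by (simp add: exp_of_nat_mult[symmetric])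
    also have "\<dots> \<le> exp (- ln n)" using L(4) by simp
    also have "\<dots> = 1 / n" using n by (simp add: exp_minus inverse_eq_divide)
    finally show ?thesis .
  qed
  have \<mu>sum: "(\<Sum>x\<in>{1..n}. pmf \<mu>\<^sub>0 x) = 1" using \<mu> by (intro sum_pmf_eq_1) auto

  let ?W = "{G \<in> space ?M. well_mixed n G (pmf \<mu>\<^sub>0) t (40 * (1 + 107 * ?C))}"
  let ?B = "\<lambda>s. {G \<in> space ?M. \<not> well_spread n d ?C (G s)}"
  have B: "?B s \<in> events" for s
    by (rule sets_edge_markovian_prefix[OF init, where t = s]) auto
  have W: "?W \<in> events"
    by (rule sets_edge_markovian_prefix[OF init, where t = t]) (rule well_mixed_cong)
  have probB: "prob (?B s) \<le> \<delta>" for s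
  proof -
    have "prob (?B s) = measure_pmf.prob ?init {E. \<not> well_spread n d ?C E}"
      by (rule prob_edge_markovian_at[OF init stat])
    also have "\<dots> \<le> \<delta>"
      unfolding \<delta>_def d_def by (rule not_well_spread_prob_le[OF r n]) (use d in \<open>simp add: d_def\<close>)
    finally show ?thesis .
  qed
  have "space ?M - (\<Union>s\<in>{m<..m + L}. ?B s) \<subseteq> ?W"
  proof
    fix G assume G: "G \<in> space ?M - (\<Union>s\<in>{m<..m + L}. ?B s)"
    have "well_mixed n G (pmf \<mu>\<^sub>0) (m + L) (40 * (1 + 107 * ?C))"
    proof (rule well_mixed_of_well_spread[OF discrepancy_const_nonneg dpos])
      show "G s \<in> graphs n" for s using G by (auto simp: space_edge_markovian[OF init])
      show "well_spread n d ?C (G s)" if "m < s" "s \<le> m + L" for s using G that by auto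
    qed (use n L decay \<mu>sum in auto)
    then show "G \<in> ?W" using G by (simp add: mL)
  qed
  then have "prob (space ?M - (\<Union>s\<in>{m<..m + L}. ?B s)) \<le> prob ?W"
    by (rule finite_measure_mono[OF _ W])
  moreover have "prob (space ?M - (\<Union>s\<in>{m<..m + L}. ?B s)) = 1 - prob (\<Union>s\<in>{m<..m + L}. ?B s)"
    using B by (intro prob_compl sets.finite_UN) auto
  moreover have "prob (\<Union>s\<in>{m<..m + L}. ?B s) \<le> (\<Sum>s\<in>{m<..m + L}. prob (?B s))"
    using B by (intro measure_UNION_le) auto
  moreover have "\<dots> \<le> L * \<delta>"
    using sum_bounded_above[of "{m<..m + L}" "\<lambda>s. prob (?B s)" \<delta>] probB by simp
  moreover have "L * \<delta> \<le> (3 * ln n + 1) * \<delta>"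
    using L(3) by (intro mult_right_mono) (auto simp: \<delta>_def intro!: add_nonneg_nonneg)
  ultimately show ?thesis unfolding \<delta>_def by linarith
qed

theorem proposition3p2:
  shows "\<exists>c\<^sub>1>0. \<exists>c\<^sub>2>0. \<forall>p q :: nat \<Rightarrow> real.
    (\<forall>n. p n \<in> {0..1} \<and> q n \<in> {0..1}) \<longrightarrow>
    (\<forall>\<^sub>F n in sequentially. p n / (p n + q n) > 2 * ln (real n) / real n) \<longrightarrow>
    q \<in> \<Omega>(\<lambda>_. 1) \<longrightarrow>
    (\<exists>\<epsilon> :: nat \<Rightarrow> real. \<epsilon> \<longlonglongrightarrow> 0 \<and>
      (\<forall>n (\<mu>\<^sub>0 :: nat pmf) t.
        set_pmf \<mu>\<^sub>0 \<subseteq> {1..n} \<longrightarrow>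
        c\<^sub>1 * ln (real n) \<le> real t \<longrightarrow>
        real t \<le> sqrt (real n) + c\<^sub>1 * ln (real n) \<longrightarrow>
        \<P>(G in edge_markovian n (p n) (q n) (erdos_renyi n (p n / (p n + q n))).
             well_mixed n G (pmf \<mu>\<^sub>0) t c\<^sub>2) \<ge> 1 - \<epsilon> n))"
proof (rule exI[of _ 3], intro conjI, simp,
    rule exI[of _ "40 * (1 + 107 * discrepancy_const)"], intro conjI allI impI)
  show "0 < 40 * (1 + 107 * discrepancy_const)" using discrepancy_const_nonneg by simp
next
  fix p q :: "nat \<Rightarrow> real"
  assume pq: "\<forall>n. p n \<in> {0..1} \<and> q n \<in> {0..1}"
    and dense: "\<forall>\<^sub>F n in sequentially. p n / (p n + q n) > 2 * ln (real n) / real n"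
  define \<delta> :: "nat \<Rightarrow> real" where "\<delta> = (\<lambda>n. (3 * ln n + 1) * (n * exp (- (6 / 5 * ln n))
    + n * exp (- (4 * ln n)) + (exp (2 * real n * exp (- (3 * ln n))) - 1)))"
  \<comment> \<open>For the finitely many remaining \<open>n\<close> the error is set to 1, which makes
    the claim trivial.\<close>
  define ok where "ok = (\<lambda>n. n \<ge> 40 \<and> p n / (p n + q n) > 2 * ln (real n) / real n)"
  define \<epsilon> where "\<epsilon> = (\<lambda>n. if ok n then \<delta> n else 1)"
  have "\<forall>\<^sub>F n in sequentially. ok n"
    unfolding ok_def by (intro eventually_conj eventually_ge_at_top dense)
  then have "\<forall>\<^sub>F n in sequentially. \<delta> n = \<epsilon> n"
    by eventually_elim (simp add: \<epsilon>_def)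
  moreover have "\<delta> \<longlonglongrightarrow> 0" unfolding \<delta>_def by real_asymp
  ultimately have lim: "\<epsilon> \<longlonglongrightarrow> 0" by (rule Lim_transform_eventually[rotated])
  show "\<exists>\<epsilon> :: nat \<Rightarrow> real. \<epsilon> \<longlonglongrightarrow> 0 \<and>
      (\<forall>n (\<mu>\<^sub>0 :: nat pmf) t.
        set_pmf \<mu>\<^sub>0 \<subseteq> {1..n} \<longrightarrow>
        3 * ln (real n) \<le> real t \<longrightarrow>
        real t \<le> sqrt (real n) + 3 * ln (real n) \<longrightarrow>
        \<P>(G in edge_markovian n (p n) (q n) (erdos_renyi n (p n / (p n + q n))).
             well_mixed n G (pmf \<mu>\<^sub>0) t (40 * (1 + 107 * discrepancy_const))) \<ge> 1 - \<epsilon> n)"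
  proof (intro exI[of _ \<epsilon>] conjI lim allI impI)
    fix n t :: nat and \<mu>\<^sub>0 :: "nat pmf"
    assume "set_pmf \<mu>\<^sub>0 \<subseteq> {1..n}" "3 * ln (real n) \<le> real t"
    then show "\<P>(G in edge_markovian n (p n) (q n) (erdos_renyi n (p n / (p n + q n))).
        well_mixed n G (pmf \<mu>\<^sub>0) t (40 * (1 + 107 * discrepancy_const))) \<ge> 1 - \<epsilon> n"
      using well_mixed_prob_ge[of "p n" "q n" n \<mu>\<^sub>0 t] pq
      by (cases "ok n") (auto simp: \<epsilon>_def \<delta>_def ok_def)
  qed
qed

end
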